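(* Let $a>b>0$, $c^2=a^2-b^2$, and let $\mathcal{E}$ be the ellipse $x^2/a^2+y^2/b^2=1$. Let $\mathcal{E}_\triangle$ be the ellipse concentric and axis-aligned with $\mathcal{E}$ with semi-axes $a_\triangle=\frac{ac^2}{a^2+3b^2}$ (along $x$) and $b_\triangle=\frac{bc^2}{3a^2+b^2}$ (along $y$), and let $C$ lie on $\mathcal{E}_\triangle$. Let $\mathcal{T}_\triangle$ be the Poncelet family of triangles inscribed in $\mathcal{E}$ and circumscribing a circle centered at $C$. Then the locus $\mathcal{L}_{59}$ of $X_{59}$ over $\mathcal{T}_\triangle$ is (up to the point missing because $X_{59}$ is undefined for the equilateral triangle) an ellipse interior to $\mathcal{E}$ and touching it at a point.
   Context: For each point $C=[x_c,y_c]$ interior to $\mathcal{E}$ there is exactly one circle $\mathcal{K}$ centered at $C$, nested in $\mathcal{E}$, admitting triangles inscribed in $\mathcal{E}$ with all sides tangent to $\mathcal{K}$; its radius is $r=\big(b\sqrt{a^4-c^2x_c^2}-a\sqrt{b^4+c^2y_c^2}\big)/c^2$. By Poncelet's porism every point of $\mathcal{E}$ is then a vertex of exactly one such triangle; the Poncelet family about the circle centered at $C$ is the family of all these triangles, and $\mathcal{K}$ is their common incircle. $\mathcal{E}_\triangle$ is the locus of centroids of all equilateral triangles inscribed in $\mathcal{E}$; when $C\in\mathcal{E}_\triangle$ the family contains an equilateral triangle. The isogonal conjugate of a point with barycentrics $[z_1:z_2:z_3]$ with respect to a triangle with sidelengths $l_1,l_2,l_3$ is $[l_1^2/z_1:l_2^2/z_2:l_3^2/z_3]$,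 equivalently $[l_1^2z_2z_3:l_2^2z_3z_1:l_3^2z_1z_2]$ (so the conjugate of a non-vertex point on a side is the opposite vertex). Feuerbach's point $X_{11}$ is the point where the incircle and the nine-point circle touch (undefined for equilateral triangles), and $X_{59}$ is the isogonal conjugate of $X_{11}$. The locus of a triangle center is the set of its positions as the triangle ranges over the family. "Interior to $\mathcal{E}$ and touching it at a point" means contained in the closed region bounded by $\mathcal{E}$ and meeting $\mathcal{E}$ exactly at one point, where the curves are tangent. *)

theory Defs
  imports "HOL-Analysis.Analysis"
begin

definition std_ellipse :: "real \<Rightarrow> real \<Rightarrow> (real^2) set" where
  "std_ellipse p q = {X. (X$1)^2 / p^2 + (X$2)^2 / q^2 = 1}"

definition std_ellipse_interior :: "real \<Rightarrow> real \<Rightarrow> (real^2) set" where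
  "std_ellipse_interior p q = {X. (X$1)^2 / p^2 + (X$2)^2 / q^2 < 1}"

definition std_ellipse_region :: "real \<Rightarrow> real \<Rightarrow> (real^2) set" where
  "std_ellipse_region p q = {X. (X$1)^2 / p^2 + (X$2)^2 / q^2 \<le> 1}"

text \<open>A nondegenerate ellipse with arbitrary centre \<open>Z\<close> and arbitrary axis directions \<open>u\<close>, \<open>v\<close>
  (circles, i.e. \<open>p = q\<close>, are included).\<close>

definition is_ellipse :: "(real^2) set \<Rightarrow> bool" where
  "is_ellipse S \<longleftrightarrow>
    (\<exists>Z u v p q. p > 0 \<and> q > 0 \<and> norm u = 1 \<and> norm v = 1 \<and> u \<bullet> v = 0 \<and>
      S = {X. ((X - Z) \<bullet> u)^2 / p^2 + ((X - Z) \<bullet> v)^2 / q^2 = 1})"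

text \<open>Only used for circles and ellipses \<open>S\<close>, where a line is tangent to \<open>S\<close> at \<open>T\<close> exactly if it
  meets \<open>S\<close> in \<open>T\<close> and nowhere else.\<close>

definition tangent_line_at :: "(real^2) set \<Rightarrow> (real^2) set \<Rightarrow> real^2 \<Rightarrow> bool" where
  "tangent_line_at l S T \<longleftrightarrow>
    (\<exists>A B. A \<noteq> B \<and> l = affine hull {A, B}) \<and> l \<inter> S = {T}"

definition tangent_curves_at :: "(real^2) set \<Rightarrow> (real^2) set \<Rightarrow> real^2 \<Rightarrow> bool" where
  "tangent_curves_at S S' T \<longleftrightarrow> (\<exists>l. tangent_line_at l S T \<and> tangent_line_at l S' T)"

definition side_tangent :: "real^2 \<Rightarrow> real^2 \<Rightarrow> (real^2) set \<Rightarrow> bool" where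
  "side_tangent P Q K \<longleftrightarrow> (\<exists>T \<in> closed_segment P Q. tangent_line_at (affine hull {P, Q}) K T)"

text \<open>The points of tangency are required to lie on the side segments, which singles out the
  incircle among the four circles tangent to the side lines.\<close>

definition is_incircle :: "real^2 \<Rightarrow> real^2 \<Rightarrow> real^2 \<Rightarrow> real^2 \<Rightarrow> real \<Rightarrow> bool" where
  "is_incircle P Q R C r \<longleftrightarrow> r > 0 \<and>
    side_tangent P Q (sphere C r) \<and> side_tangent Q R (sphere C r) \<and> side_tangent R P (sphere C r)"

definition is_nine_point_circle :: "real^2 \<Rightarrow> real^2 \<Rightarrow> real^2 \<Rightarrow> real^2 \<Rightarrow> real \<Rightarrow> bool" where
  "is_nine_point_circle P Q R N s \<longleftrightarrow> s > 0 \<and>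
    {midpoint P Q, midpoint Q R, midpoint R P} \<subseteq> sphere N s"

text \<open>For an equilateral triangle the two circles coincide, so that no \<open>F\<close> qualifies.\<close>

definition is_X11 :: "real^2 \<Rightarrow> real^2 \<Rightarrow> real^2 \<Rightarrow> real^2 \<Rightarrow> bool" where
  "is_X11 P Q R F \<longleftrightarrow>
    (\<exists>C r N s. is_incircle P Q R C r \<and> is_nine_point_circle P Q R N s \<and>
      sphere C r \<inter> sphere N s = {F})"

text \<open>Here \<open>z1\<close>, \<open>z2\<close>, \<open>z3\<close> are the normalized barycentric coordinates of \<open>Z\<close>. The conjugate is
  taken in the denominator-free form \<open>[l1^2 z2 z3 : l2^2 z3 z1 : l3^2 z1 z2]\<close>, which also covers
  points on the side lines; \<open>w1 + w2 + w3 \<noteq> 0\<close> says that it is a finite point.\<close>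

definition is_isogonal_conjugate ::
    "real^2 \<Rightarrow> real^2 \<Rightarrow> real^2 \<Rightarrow> real^2 \<Rightarrow> real^2 \<Rightarrow> bool" where
  "is_isogonal_conjugate P Q R Z X \<longleftrightarrow>
    (\<exists>z1 z2 z3 w1 w2 w3 :: real.
      z1 + z2 + z3 = 1 \<and> Z = z1 *\<^sub>R P + z2 *\<^sub>R Q + z3 *\<^sub>R R \<and>
      w1 = (dist Q R)^2 * z2 * z3 \<and> w2 = (dist R P)^2 * z3 * z1 \<and> w3 = (dist P Q)^2 * z1 * z2 \<and>
      w1 + w2 + w3 \<noteq> 0 \<and>
      X = (1 / (w1 + w2 + w3)) *\<^sub>R (w1 *\<^sub>R P + w2 *\<^sub>R Q + w3 *\<^sub>R R))"

definition is_X59 :: "real^2 \<Rightarrow> real^2 \<Rightarrow> real^2 \<Rightarrow> real^2 \<Rightarrow> bool" where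
  "is_X59 P Q R X \<longleftrightarrow> (\<exists>F. is_X11 P Q R F \<and> is_isogonal_conjugate P Q R F X)"

text \<open>The radius may be quantified existentially per triangle: for \<open>C\<close> interior to the ellipse there
  is only one radius for which such triangles exist.\<close>

definition poncelet_family :: "real \<Rightarrow> real \<Rightarrow> real^2 \<Rightarrow> ((real^2) \<times> (real^2) \<times> (real^2)) set" where
  "poncelet_family a b C =
    {(P, Q, R). \<not> collinear {P, Q, R} \<and> {P, Q, R} \<subseteq> std_ellipse a b \<and>
      (\<exists>r. is_incircle P Q R C r \<and> sphere C r \<subseteq> std_ellipse_interior a b)}"

definition locus ::
    "(real^2 \<Rightarrow> real^2 \<Rightarrow> real^2 \<Rightarrow> real^2 \<Rightarrow> bool) \<Rightarrow> ((real^2) \<times> (real^2) \<times> (real^2)) set \<Rightarrow> (real^2) set" where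
  "locus is_center \<T> = {X. \<exists>(P, Q, R) \<in> \<T>. is_center P Q R X}"

definition interior_touching_at :: "(real^2) set \<Rightarrow> real \<Rightarrow> real \<Rightarrow> real^2 \<Rightarrow> bool" where
  "interior_touching_at L a b T \<longleftrightarrow>
    L \<subseteq> std_ellipse_region a b \<and> L \<inter> std_ellipse a b = {T} \<and>
    tangent_curves_at L (std_ellipse a b) T"

end

theory Submission
  imports Defs "HOL-Computational_Algebra.Fundamental_Theorem_Algebra"
begin

text \<open>
  Take complex coordinates in which the incircle is the unit circle and let \<open>u\<close>, \<open>v\<close>, \<open>w\<close> be the
  points of contact, so that the vertices are \<open>2vw/(v+w)\<close> and its cyclic analogues. With
  \<open>\<lambda> = uvw\<close>, closing up in \<open>\<E>\<close> becomes an affine equation \<open>u + v + w = k\<lambda> + k'\<close>. When the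
  family contains an equilateral triangle, \<open>k'\<close> is the conjugate of \<open>k\<close> after a rotation, and
  \<open>|k| = c\<^sup>2 / (2(a\<^sup>2 + b\<^sup>2)) < 1/2\<close>. Then \<open>u + v + w = uv + vw + wu =: s\<close>, so that Feuerbach's point,
  which is \<open>(uv + vw + wu) / (u + v + w)\<close> in these coordinates, is the fixed point \<open>1\<close>; it is
  undefined exactly for \<open>s = 0\<close>, the equilateral triangle. The isogonal conjugate of the point \<open>1\<close> is
  \<open>-2(2 - s + \<lambda>) / (3 - 4 Re s + |s|\<^sup>2)\<close>, whose numerator and denominator are real affine in \<open>\<lambda>\<close> on the unit
  circle. Hence it traces a projective image of the circle, and the denominator does not vanish on the
  closed disc, so this image is an ellipse. Inserting the point into the equation of \<open>\<E>\<close> gives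
  a negative multiple of \<open>(1 - Re \<lambda>)(1 - Re k\<lambda>)\<close>, which vanishes only at \<open>\<lambda> = 1\<close>, where \<open>X\<^sub>5\<^sub>9\<close> is the
  vertex opposite to the side touched at Feuerbach's point.
\<close>

section \<open>Contact triangles in the complex plane\<close>

lemma unit_cnj: "cmod z = 1 \<Longrightarrow> cnj z = 1 / z"
  by (metis complex_div_cnj complex_cnj_one div_by_1 mult_1 norm_one power_one of_real_1)

lemma quadratic_three_roots:
  fixes p q r :: complex
  assumes "u \<noteq> v" "v \<noteq> w" "w \<noteq> u"
    and "p * u^2 + q * u + r = 0" "p * v^2 + q * v + r = 0" "p * w^2 + q * w + r = 0"
  shows "p = 0" "q = 0" "r = 0"
proof -
  have "(u - v) * (p * (u + v) + q) = 0" using assms(4,5) by algebra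
  moreover have "(w - v) * (p * (w + v) + q) = 0" using assms(5,6) by algebra
  ultimately have e: "p * (u + v) + q = 0" "p * (w + v) + q = 0"
    using assms(1-3) by auto
  hence "p * (u - w) = 0" by algebra
  thus "p = 0" using assms by auto
  thus "q = 0" using e by auto
  thus "r = 0" using \<open>p = 0\<close> assms by auto
qed

text \<open>Since \<open>cnj t = 1 / t\<close> on the unit circle, the tangent condition
  \<open>Re (P * cnj t) = 1\<close> reads P + cnj P t^2 = 2t. Thus v and w are the two roots of one
  quadratic in t, and Vieta yields the pole of the chord vw.\<close>

lemma tangents_meet:
  assumes "cmod v = 1" "cmod w = 1" "v \<noteq> w" "Re (P * cnj v) = 1" "Re (P * cnj w) = 1"
  shows "v + w \<noteq> 0" "P = 2 * v * w / (v + w)"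
proof -
  have nz: "v \<noteq> 0" "w \<noteq> 0" using assms by auto
  have *: "P / t + cnj P * t = 2" if "cmod t = 1" "Re (P * cnj t) = 1" for t
  proof -
    have "P * cnj t + cnj (P * cnj t) = 2" using that complex_add_cnj[of "P * cnj t"] by simp
    thus ?thesis using unit_cnj[OF that(1)] by simp
  qed
  have 1: "P + cnj P * v^2 = 2 * v" "P + cnj P * w^2 = 2 * w"
    using *[OF assms(1,4)] *[OF assms(2,5)] nz by (auto simp: field_simps power2_eq_square)
  hence "(v - w) * (cnj P * (v + w) - 2) = 0" by algebra
  hence 2: "cnj P * (v + w) = 2" using assms(3) by auto
  thus n: "v + w \<noteq> 0" by auto
  have "P * (v + w) = 2 * v * w" using 1 2 by algebra
  thus "P = 2 * v * w / (v + w)" using n by (simp add: field_simps)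
qed

text \<open>Up to a positive factor this is the equation of the given ellipse in the coordinate with
  unit incircle and Feuerbach's point at 1. The modulus of \<open>k\<close> encodes the shape and
  its argument the axis directions. The scaling vector of the frame is chosen so that the same
  \<open>k\<close> governs the linear part; the constant -4 then expresses that the incentre lies on
  the locus of equilateral centroids.\<close>

definition ellipse_form :: "complex \<Rightarrow> complex \<Rightarrow> real" where
  "ellipse_form k z = (cmod z)^2 - 2 * Re (k * z^2) + 4 * Re (k * z) - 4"

lemma ellipse_form_complex:
  "complex_of_real (ellipse_form k z) =
    z * cnj z - (k * z^2 + cnj k * cnj z^2) + 2 * (k * z + cnj k * cnj z) - 4"
proof -
  have 1: "complex_of_real (2 * Re x) = x + cnj x" for x by (simp add: complex_add_cnj)
  have "ellipse_form k z = (cmod z)^2 - 2 * Re (k * z^2) + 2 * (2 * Re (k * z)) - 4"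
    by (simp add: ellipse_form_def)
  also have "complex_of_real \<dots> = z * cnj z - (k * z^2 + cnj (k * z^2)) + 2 * (k * z + cnj (k * z)) - 4"
    unfolding of_real_diff of_real_add 1 complex_norm_square of_real_mult[of 2 "2 * Re (k * z)"]
    by simp
  finally show ?thesis by simp
qed

lemma cnj_tangent_vertex:
  assumes "cmod v = 1" "cmod w = 1" "v + w \<noteq> 0"
  shows "cnj (2 * v * w / (v + w)) = 2 / (v + w)"
proof -
  have nz: "v \<noteq> 0" "w \<noteq> 0" using assms by auto
  have "cnj (v + w) = (v + w) / (v * w)"
    using nz by (simp add: unit_cnj[OF assms(1)] unit_cnj[OF assms(2)] field_simps)
  hence "cnj (2 * v * w / (v + w)) = 2 * (1 / v) * (1 / w) / ((v + w) / (v * w))"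
    by (simp only: complex_cnj_divide complex_cnj_mult complex_cnj_numeral unit_cnj[OF assms(1)] unit_cnj[OF assms(2)])
  thus ?thesis using nz by simp
qed

text \<open>The factor \<tau> keeps the inradius open, because the family does not prescribe it.
  Conjugates of \<open>v\<close> and \<open>w\<close> are reciprocals, so clearing (v + w)^2 leaves
  a polynomial in v and w.\<close>

lemma ellipse_form_vertex:
  assumes "cmod v = 1" "cmod w = 1" "v + w \<noteq> 0"
  shows "of_real (ellipse_form k (of_real \<tau> * (2 * v * w / (v + w)))) * (v + w)^2 =
    4 * (of_real \<tau>^2 * (v * w) - of_real \<tau>^2 * (k * (v * w)^2 + cnj k) +
      of_real \<tau> * (v + w) * (k * (v * w) + cnj k) - (v + w)^2)"
proof -
  note c = cnj_tangent_vertex[OF assms]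
  define P where "P = 2 * v * w / (v + w)"
  define P' where "P' = 2 / (v + w)"
  have 1: "P * (v + w) = 2 * v * w" "P' * (v + w) = 2" unfolding P_def P'_def using assms(3) by (metis nonzero_eq_divide_eq)+
  have c': "cnj P = P'" using c P_def P'_def by simp
  have "of_real (ellipse_form k (of_real \<tau> * P)) = of_real \<tau>^2 * P * P' - of_real \<tau>^2 * (k * P^2 + cnj k * P'^2) + 2 * of_real \<tau> * (k * P + cnj k * P') - 4"
    unfolding ellipse_form_complex using c' by (simp add: algebra_simps power2_eq_square)
  hence "of_real (ellipse_form k (of_real \<tau> * P)) * (v + w)^2 =
     of_real \<tau>^2 * (P * (v+w)) * (P' * (v+w)) - of_real \<tau>^2 * (k * (P * (v+w))^2 + cnj k * (P' * (v+w))^2) + 2 * of_real \<tau> * (k * (P * (v+w)) + cnj k * (P' * (v+w))) * (v+w) - 4 * (v+w)^2"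
    by algebra
  thus ?thesis unfolding 1 P_def[symmetric] by (simp add: algebra_simps power2_eq_square)
qed

lemma cnj_sum_unit:
  assumes "cmod u = 1" "cmod v = 1" "cmod w = 1"
  shows "u * v + v * w + w * u = u * v * w * cnj (u + v + w)"
proof -
  have nz: "u \<noteq> 0" "v \<noteq> 0" "w \<noteq> 0" using assms by auto
  show ?thesis using assms nz by (simp add: unit_cnj field_simps)
qed

text \<open>Multiplied by \<open>u\<^sup>2\<close> and reduced modulo the cubic with roots \<open>u\<close>, \<open>v\<close>, \<open>w\<close>, the equation for the
  vertex opposite to \<open>u\<close> is quadratic in \<open>u\<close> with coefficients symmetric in \<open>u\<close>, \<open>v\<close>, \<open>w\<close>. Having
  three roots, it vanishes identically.\<close>

lemma poncelet_condition:
  assumes un: "cmod u = 1" "cmod v = 1" "cmod w = 1"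
    and ds: "u \<noteq> v" "v \<noteq> w" "w \<noteq> u"
    and nz: "v + w \<noteq> 0" "w + u \<noteq> 0" "u + v \<noteq> 0"
    and E: "ellipse_form k (of_real \<tau> * (2 * v * w / (v + w))) = 0"
      "ellipse_form k (of_real \<tau> * (2 * w * u / (w + u))) = 0"
      "ellipse_form k (of_real \<tau> * (2 * u * v / (u + v))) = 0"
  shows "u + v + w = of_real \<tau>^2 * k * (u * v * w) + of_real \<tau> * cnj k"
    and "(1 - \<tau>^2) * (1 - (cmod k)^2 * \<tau>^2) = 0"
proof -
  define s where "s = u + v + w"
  define l where "l = u * v * w"
  define \<sigma> where "\<sigma> = u * v + v * w + w * u"
  define t where "t = complex_of_real \<tau>"
  have nz0: "u \<noteq> 0" "v \<noteq> 0" "w \<noteq> 0" using un by auto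
  have *: "(- (t^2) * cnj k - t * k * l + \<sigma>) * x^2 + (t^2 * l + t * k * l * s + t * cnj k * \<sigma> - s * \<sigma> - l) * x
      + (- (t^2) * k * l^2 - t * cnj k * l + l * s) = 0"
    if un': "cmod y = 1" "cmod z = 1" and n: "y + z \<noteq> 0"
     and E: "ellipse_form k (of_real \<tau> * (2 * y * z / (y + z))) = 0"
     and sym: "x + y + z = s" "x * y * z = l" "x * y + y * z + z * x = \<sigma>" for x y z
  proof -
    have "t^2 * (y * z) - t^2 * (k * (y * z)^2 + cnj k) + t * (y + z) * (k * (y * z) + cnj k) - (y + z)^2 = 0"
      using ellipse_form_vertex[OF un' n, of k \<tau>, unfolded E of_real_0] unfolding t_def by algebra
    thus ?thesis using sym by algebra
  qed
  have 1: "(- (t^2) * cnj k - t * k * l + \<sigma>) * u^2 + (t^2 * l + t * k * l * s + t * cnj k * \<sigma> - s * \<sigma> - l) * u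
      + (- (t^2) * k * l^2 - t * cnj k * l + l * s) = 0"
    by (rule *[of v w, OF un(2,3) nz(1) E(1)]) (auto simp: s_def l_def \<sigma>_def)
  have 2: "(- (t^2) * cnj k - t * k * l + \<sigma>) * v^2 + (t^2 * l + t * k * l * s + t * cnj k * \<sigma> - s * \<sigma> - l) * v
      + (- (t^2) * k * l^2 - t * cnj k * l + l * s) = 0"
    by (rule *[of w u, OF un(3,1) nz(2) E(2)]) (auto simp: s_def l_def \<sigma>_def algebra_simps)
  have 3: "(- (t^2) * cnj k - t * k * l + \<sigma>) * w^2 + (t^2 * l + t * k * l * s + t * cnj k * \<sigma> - s * \<sigma> - l) * w
      + (- (t^2) * k * l^2 - t * cnj k * l + l * s) = 0"
    by (rule *[of u v, OF un(1,2) nz(3) E(3)]) (auto simp: s_def l_def \<sigma>_def algebra_simps)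
  note z = quadratic_three_roots[OF ds 1 2 3]
  have l0: "l \<noteq> 0" using nz0 by (simp add: l_def)
  have "l * (s - (t^2 * k * l + t * cnj k)) = 0" using z(3) by algebra
  hence s: "s = t^2 * k * l + t * cnj k" using l0 by simp
  thus "u + v + w = of_real \<tau>^2 * k * (u * v * w) + of_real \<tau> * cnj k"
    by (simp add: s_def l_def t_def)
  have sg: "\<sigma> = t * k * l + t^2 * cnj k" using z(1) by algebra
  \<comment> \<open>With s and \<sigma> known from the two outer coefficients, the middle
    coefficient no longer restricts the contact points: up to the factor -l it is a condition on the
    radius alone.\<close>
  have "l * ((1 - t^2) * (1 - k * cnj k * t^2)) = 0"
    using z(2) s sg by algebra
  hence "(1 - t^2) * (1 - k * cnj k * t^2) = 0" using l0 by simp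
  hence "complex_of_real ((1 - \<tau>^2) * (1 - (cmod k)^2 * \<tau>^2)) = 0"
    unfolding t_def complex_norm_square[symmetric] by (simp add: t_def)
  thus "(1 - \<tau>^2) * (1 - (cmod k)^2 * \<tau>^2) = 0" using of_real_eq_0_iff by blast
qed

text \<open>Converse of \<open>poncelet_condition\<close> at radius 1. Conjugating the affine
  relation gives the same value for uv + vw + wu, and the vertex equation is a polynomial
  consequence of the two relations.\<close>

lemma vertex_on_ellipse:
  assumes un: "cmod u = 1" "cmod v = 1" "cmod w = 1"
    and nz: "v + w \<noteq> 0"
    and s: "u + v + w = k * (u * v * w) + cnj k"
  shows "ellipse_form k (2 * v * w / (v + w)) = 0"
proof -
  have nz0: "u \<noteq> 0" "v \<noteq> 0" "w \<noteq> 0" using un by auto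
  have "cnj (u + v + w) = cnj (k * (u * v * w) + cnj k)" using s by simp
  hence "1/u + 1/v + 1/w = cnj k / (u * v * w) + k"
    using un by (simp add: unit_cnj)
  hence s': "v * w + u * w + u * v = cnj k + k * (u * v * w)"
    using nz0 by (simp add: field_simps)
  have "v * w - (k * (v * w)^2 + cnj k) + (v + w) * (k * (v * w) + cnj k) - (v + w)^2 = 0"
    using s s' by algebra
  hence "of_real (ellipse_form k (2 * v * w / (v + w))) * (v + w)^2 = 0"
    using ellipse_form_vertex[OF un(2,3) nz, of k 1] by simp
  thus ?thesis using nz by simp
qed

text \<open>The cubic equation says that \<open>l\<close> is the value at \<open>z\<close> of the Blaschke product
  \<open>z\<^sup>2 (z - s) / (1 - cnj s z)\<close>, so that its roots lie on the unit circle.\<close>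

lemma touch_points_exist:
  assumes l: "cmod l = 1" and s: "cmod s < 1" and sl: "l * cnj s = s"
  obtains u v w where "cmod u = 1" "cmod v = 1" "cmod w = 1"
    "u + v + w = s" "u * v + v * w + w * u = s" "u * v * w = l"
proof -
  have ex: "\<exists>z. z^3 - s * z^2 + s * z - l = 0"
  proof -
    have "\<not> constant (poly [:-l, s, -s, 1:])" by (simp add: constant_degree)
    from fundamental_theorem_of_algebra[OF this] show ?thesis
      by (auto simp: algebra_simps power2_eq_square power3_eq_cube)
  qed
  have root: "cmod z = 1" if z: "z^3 - s * z^2 + s * z - l = 0" for z
  proof -
    have "z^2 * (z - s) = l * (1 - cnj s * z)" using z sl by algebra
    hence e: "cmod z^2 * cmod (z - s) = cmod (1 - cnj s * z)"
      using l by (metis mult_1 norm_mult norm_power)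
    have d: "(cmod (1 - cnj s * z))^2 - (cmod (z - s))^2 = (1 - (cmod s)^2) * (1 - (cmod z)^2)"
      unfolding cmod_power2 by (simp add: algebra_simps power2_eq_square)
    have s2: "0 < 1 - (cmod s)^2" using s by (simp add: abs_square_less_1)
    define n where "n = (cmod z)^2"
    define y where "y = (cmod (z - s))^2"
    have e': "n^2 * y = (cmod (1 - cnj s * z))^2"
      unfolding n_def y_def e[symmetric] by algebra
    have "n^2 * y - y = (1 - (cmod s)^2) * (1 - n)" using e' d by (simp add: n_def y_def)
    hence "(n - 1) * ((n + 1) * y + (1 - (cmod s)^2)) = 0" by algebra
    moreover have "(n + 1) * y + (1 - (cmod s)^2) > 0" 
      by (rule add_nonneg_pos) (use s2 in \<open>auto simp: n_def y_def\<close>)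
    ultimately have "n = 1" by simp
    thus ?thesis unfolding n_def using power2_eq_1_iff by (metis norm_ge_zero norm_one abs_norm_cancel abs_1 power2_eq_iff_nonneg power_one zero_le_one)
  qed
  obtain u where u: "u^3 - s * u^2 + s * u - l = 0" using ex by blast
  \<comment> \<open>The other two roots have sum s - u and product s - u(s - u); \<open>D\<close> is
    the square root of the discriminant of their quadratic.\<close>
  define D where "D = csqrt ((s - u)^2 - 4 * (s - u * (s - u)))"
  have D: "D^2 = (s - u)^2 - 4 * (s - u * (s - u))" by (simp add: D_def)
  define v where "v = ((s - u) + D) / 2"
  define w where "w = ((s - u) - D) / 2"
  have v2: "2 * v = s - u + D" and w2: "2 * w = s - u - D" by (auto simp: v_def w_def)
  have 1: "u + v + w = s" using v2 w2 by algebra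
  have "4 * (u * v + v * w + w * u) = 4 * s" using v2 w2 D by algebra
  hence 2: "u * v + v * w + w * u = s" by algebra
  have 3: "u * v * w = l" using u 1 2 by algebra
  have "v^3 - (u + v + w) * v^2 + (u * v + v * w + w * u) * v - u * v * w = 0" by algebra
  hence "v^3 - s * v^2 + s * v - l = 0" unfolding 1 2 3 .
  moreover have "w^3 - (u + v + w) * w^2 + (u * v + v * w + w * u) * w - u * v * w = 0" by algebra
  hence "w^3 - s * w^2 + s * w - l = 0" unfolding 1 2 3 .
  ultimately show ?thesis using root u 1 2 3 by (intro that[of u v w]) auto
qed

text \<open>Two equal contact points already contribute length 2, and two opposite ones cancel and
  leave the third; in both cases the sum leaves the open unit disc. Opposite contact points would
  mean parallel side lines.\<close>

lemma touch_points_distinct: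
  assumes un: "cmod u = 1" "cmod v = 1" "cmod w = 1" and s: "cmod (u + v + w) < 1"
  shows "v \<noteq> w" "v + w \<noteq> 0"
proof -
  show "v \<noteq> w"
  proof
    assume "v = w"
    hence "cmod (2 * w) \<le> cmod (u + v + w) + cmod u"
      using norm_triangle_ineq4[of "u + v + w" u] by simp
    thus False using un s by (simp add: norm_mult)
  qed
  show "v + w \<noteq> 0"
  proof
    assume "v + w = 0"
    hence "u + v + w = u" by (metis add.assoc add.right_neutral)
    hence "cmod (u + v + w) = cmod u" by (rule arg_cong)
    thus False using un s by linarith
  qed
qed

section \<open>The isogonal conjugate of the point 1 in terms of the contact points\<close>

definition conj_denom :: "complex \<Rightarrow> real" where
  "conj_denom s = 3 - 4 * Re s + (cmod s)^2"

text \<open>The value is |2 - s|^2 - 1, and every s in the open unit disc is farther than 1 from the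
  point 2.\<close>

lemma conj_denom_pos: "cmod s < 1 \<Longrightarrow> conj_denom s > 0"
proof -
  assume s: "cmod s < 1"
  have "0 < (1 - cmod s) * (3 - cmod s)" using s by simp
  also have "\<dots> = 3 - 4 * cmod s + (cmod s)^2" by (simp add: algebra_simps power2_eq_square)
  also have "\<dots> \<le> conj_denom s" using complex_Re_le_cmod[of s] by (simp add: conj_denom_def)
  finally show ?thesis .
qed

lemma conj_denom_complex:
  "complex_of_real (conj_denom s) = 3 - 2 * (s + cnj s) + s * cnj s"
  by (simp add: conj_denom_def complex_norm_square[symmetric] complex_add_cnj)

text \<open>The equation for the point 1, its conjugate and the normalization are three linear
  equations for z1, z2, z3. The factor (1 - u)^2 reflects that z1 is proportional to the distance of
  1 from the tangent at u, which is -(1 - u)^2 / (2u).\<close>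

lemma touch_barycentric:
  assumes un: "cmod u = 1" "cmod v = 1" "cmod w = 1"
    and nz: "v + w \<noteq> 0" "w + u \<noteq> 0" "u + v \<noteq> 0"
    and z: "z1 + z2 + z3 = 1" and
      Z: "of_real z1 * (2 * v * w / (v + w)) + of_real z2 * (2 * w * u / (w + u)) + of_real z3 * (2 * u * v / (u + v)) = 1"
  shows "of_real z1 * (2 * (u - v) * (u - w)) = (1 - u)^2 * (v + w)"
proof -
  define a b c where "a = 1 / (v + w)" and "b = 1 / (w + u)" and "c = 1 / (u + v)"
  have abc: "a * (v + w) = 1" "b * (w + u) = 1" "c * (u + v) = 1"
    using nz by (auto simp: a_def b_def c_def)
  have Z1: "of_real z1 * (2 * v * w * a) + of_real z2 * (2 * w * u * b) + of_real z3 * (2 * u * v * c) = 1"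
    using Z by (simp add: a_def b_def c_def)
  have "cnj (of_real z1 * (2 * v * w / (v + w)) + of_real z2 * (2 * w * u / (w + u)) + of_real z3 * (2 * u * v / (u + v))) = 1"
    unfolding Z by simp
  hence Z2: "of_real z1 * (2 * a) + of_real z2 * (2 * b) + of_real z3 * (2 * c) = 1"
    unfolding complex_cnj_add complex_cnj_mult[of "of_real _"] complex_cnj_complex_of_real
      cnj_tangent_vertex[OF un(2,3) nz(1)] cnj_tangent_vertex[OF un(3,1) nz(2)]
      cnj_tangent_vertex[OF un(1,2) nz(3)] by (simp add: a_def b_def c_def)
  have Z3: "complex_of_real z1 + of_real z2 + of_real z3 = 1"
    using z by (metis of_real_1 of_real_add)
  have "of_real z1 * a * (2 * (u - v) * (u - w)) = (1 - u)^2"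
    using Z1 Z2 Z3 abc by algebra
  thus ?thesis using abc(1) by algebra
qed

lemma side_length_sq:
  assumes un: "cmod u = 1" "cmod v = 1" "cmod w = 1"
    and nz: "w + u \<noteq> 0" "u + v \<noteq> 0"
  shows "of_real ((cmod (2 * w * u / (w + u) - 2 * u * v / (u + v)))^2) * ((w + u)^2 * (u + v)^2) = - 4 * u^2 * (v - w)^2"
proof -
  define b c where "b = 1 / (w + u)" and "c = 1 / (u + v)"
  have bc: "b * (w + u) = 1" "c * (u + v) = 1"
    using nz by (auto simp: b_def c_def)
  have "of_real ((cmod (2 * w * u / (w + u) - 2 * u * v / (u + v)))^2) = (2 * w * u * b - 2 * u * v * c) * (2 * b - 2 * c)"
    unfolding complex_norm_square complex_cnj_diff cnj_tangent_vertex[OF un(3,1) nz(1)]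
      cnj_tangent_vertex[OF un(1,2) nz(2)] by (simp add: b_def c_def)
  thus ?thesis using bc by algebra
qed

lemma isogonal_weight:
  assumes un: "cmod u = 1" "cmod v = 1" "cmod w = 1"
    and ds: "u \<noteq> v" "v \<noteq> w" "w \<noteq> u"
    and nz: "v + w \<noteq> 0" "w + u \<noteq> 0" "u + v \<noteq> 0"
    and z: "z1 + z2 + z3 = 1" and
      Z: "of_real z1 * (2 * v * w / (v + w)) + of_real z2 * (2 * w * u / (w + u)) + of_real z3 * (2 * u * v / (u + v)) = 1"
  shows "of_real ((cmod (2 * w * u / (w + u) - 2 * u * v / (u + v)))^2 * z2 * z3) =
    u^2 * (1 - v)^2 * (1 - w)^2 / ((w + u) * (u + v) * (u - v) * (u - w))"
proof -
  have 2: "of_real z2 * (2 * (v - w) * (v - u)) = (1 - v)^2 * (w + u)"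
    by (rule touch_barycentric[of v w u z2 z3 z1]) (use un nz z Z in \<open>simp_all add: algebra_simps\<close>)
  have 3: "of_real z3 * (2 * (w - u) * (w - v)) = (1 - w)^2 * (u + v)"
    by (rule touch_barycentric[of w u v z3 z1 z2]) (use un nz z Z in \<open>simp_all add: algebra_simps\<close>)
  define y2 y3 l where "y2 = complex_of_real z2" and "y3 = complex_of_real z3"
    and "l = complex_of_real ((cmod (2 * w * u / (w + u) - 2 * u * v / (u + v)))^2)"
  have l: "l * ((w + u)^2 * (u + v)^2) = - 4 * u^2 * (v - w)^2"
    unfolding l_def by (rule side_length_sq[OF un nz(2,3)])
  \<comment> \<open>Multiplying the two barycentric equations and the side length equation leaves
    4(v - w)^2 (w + u)(u + v) as a common factor of both sides, which is then cancelled.\<close>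
  have "4 * (v - w)^2 * (w + u) * (u + v) * (l * y2 * y3 * ((w + u) * (u + v) * (u - v) * (u - w)) - u^2 * (1 - v)^2 * (1 - w)^2) = 0"
    using 2 3 l unfolding y2_def[symmetric] y3_def[symmetric] by algebra
  moreover have "4 * (v - w)^2 * (w + u) * (u + v) \<noteq> 0" using ds nz by simp
  ultimately have "l * y2 * y3 * ((w + u) * (u + v) * (u - v) * (u - w)) = u^2 * (1 - v)^2 * (1 - w)^2"
    by (metis mult_eq_0_iff eq_iff_diff_eq_0)
  moreover have "(w + u) * (u + v) * (u - v) * (u - w) \<noteq> 0" using ds nz by auto
  ultimately show ?thesis by (simp add: l_def y2_def y3_def nonzero_eq_divide_eq)
qed

text \<open>Over the common denominator \<open>V * p\<close>, with \<open>V\<close> the Vandermonde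
  product, the three weights become polynomials permuted cyclically. Their sum and the weighted sum
  of the vertices are alternating, hence \<open>V\<close> times symmetric polynomials, which depend
  on s and l only.\<close>

lemma isogonal_image:
  fixes u v w :: complex and z1 z2 z3 :: real
  defines "P \<equiv> 2 * v * w / (v + w)" and "Q \<equiv> 2 * w * u / (w + u)" and "R \<equiv> 2 * u * v / (u + v)"
  defines "w1 \<equiv> (cmod (Q - R))^2 * z2 * z3" and "w2 \<equiv> (cmod (R - P))^2 * z3 * z1"
    and "w3 \<equiv> (cmod (P - Q))^2 * z1 * z2"
  assumes un: "cmod u = 1" "cmod v = 1" "cmod w = 1"
    and ds: "u \<noteq> v" "v \<noteq> w" "w \<noteq> u"
    and nz: "v + w \<noteq> 0" "w + u \<noteq> 0" "u + v \<noteq> 0"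
    and s: "u + v + w = s" "u * v + v * w + w * u = s" "u * v * w = l"
    and s1: "cmod s < 1"
    and z: "z1 + z2 + z3 = 1" "of_real z1 * P + of_real z2 * Q + of_real z3 * R = 1"
  shows "w1 + w2 + w3 \<noteq> 0"
    and "of_real w1 * P + of_real w2 * Q + of_real w3 * R =
      of_real (w1 + w2 + w3) * (- 2 * (2 - s + l) / of_real (conj_denom s))"
proof -
  define V where "V = (u - v) * (v - w) * (w - u)"
  define p where "p = (u + v) * (v + w) * (w + u)"
  have nz0: "u \<noteq> 0" "v \<noteq> 0" "w \<noteq> 0" using un by auto
  have VP: "V * p \<noteq> 0" using ds nz by (auto simp: V_def p_def)
  \<comment> \<open>The denominator of a single weight, multiplied by -(b^2 - c^2), is
    \<open>V * p\<close>.\<close>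
  have weight: "of_real y * (V * p) = - (a^2 * (1 - b)^2 * (1 - c)^2 * (b^2 - c^2))"
    if "of_real y = a^2 * (1 - b)^2 * (1 - c)^2 / ((c + a) * (a + b) * (a - b) * (a - c))"
      "(a - b) * (b - c) * (c - a) = V" "(a + b) * (b + c) * (c + a) = p" for y a b c
  proof -
    have "(c + a) * (a + b) * (a - b) * (a - c) \<noteq> 0" using VP that(2,3) by auto
    hence "of_real y * ((c + a) * (a + b) * (a - b) * (a - c)) = a^2 * (1 - b)^2 * (1 - c)^2"
      using that(1) by (simp add: nonzero_eq_divide_eq)
    thus ?thesis using that(2,3) by algebra
  qed
  have W1: "of_real w1 * (V * p) = - (u^2 * (1 - v)^2 * (1 - w)^2 * (v^2 - w^2))"
    by (rule weight) (use isogonal_weight[OF un ds nz z(1), folded P_def Q_def R_def, OF z(2)] in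
      \<open>simp_all add: w1_def V_def p_def\<close>)
  have W2: "of_real w2 * (V * p) = - (v^2 * (1 - w)^2 * (1 - u)^2 * (w^2 - u^2))"
    by (rule weight) (use isogonal_weight[OF un(2,3,1) ds(2,3,1) nz(2,3,1), folded P_def Q_def R_def, of z2 z3 z1] z in
      \<open>simp_all add: w2_def V_def p_def algebra_simps\<close>)
  have W3: "of_real w3 * (V * p) = - (w^2 * (1 - u)^2 * (1 - v)^2 * (u^2 - v^2))"
    by (rule weight) (use isogonal_weight[OF un(3,1,2) ds(3,1,2) nz(3,1,2), folded P_def Q_def R_def, of z3 z1 z2] z in
      \<open>simp_all add: w3_def V_def p_def algebra_simps\<close>)
  have sl: "s = l * cnj s" using cnj_sum_unit[OF un] s by simp
  define D where "D = complex_of_real (conj_denom s)"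
  \<comment> \<open>Multiplication by l turns cnj s into s, so that the real denominator becomes a
    polynomial in s and l.\<close>
  have D: "l * D = 3 * l - 2 * s * l - 2 * s + s^2"
    using sl unfolding D_def conj_denom_complex by algebra
  have D0: "D \<noteq> 0" using conj_denom_pos[OF s1] by (simp add: D_def)
  have "of_real (w1 + w2 + w3) * (V * p) = - (V * (3 * l - 2 * s * l - 2 * s + s * s))"
  proof -
    have "of_real (w1 + w2 + w3) * (V * p) = - (u^2 * (1 - v)^2 * (1 - w)^2 * (v^2 - w^2)) 
      - (v^2 * (1 - w)^2 * (1 - u)^2 * (w^2 - u^2)) - (w^2 * (1 - u)^2 * (1 - v)^2 * (u^2 - v^2))"
      using W1 W2 W3 by (simp add: distrib_right)
    also have "\<dots> = - (V * (3 * (u * v * w) - 2 * (u + v + w) * (u * v * w) - 2 * (u * v + v * w + w * u)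
        + (u + v + w) * (u * v + v * w + w * u)))"
      unfolding V_def by algebra
    finally show ?thesis unfolding s .
  qed
  hence W: "of_real (w1 + w2 + w3) * (V * p) = - (V * l * D)" using D by algebra
  have l0: "l \<noteq> 0" using nz0 s by auto
  have V0: "V \<noteq> 0" using VP by auto
  have "of_real (w1 + w2 + w3) * (V * p) \<noteq> 0" unfolding W using D0 l0 V0 by simp
  thus "w1 + w2 + w3 \<noteq> 0" using VP by (metis mult_zero_left of_real_0)
  have PQR: "P * (v + w) = 2 * v * w" "Q * (w + u) = 2 * w * u" "R * (u + v) = 2 * u * v"
    using nz by (simp_all add: P_def Q_def R_def)
  have "of_real w1 * P * (V * p) = - (2 * l * u * (1 - v)^2 * (1 - w)^2 * (v - w))"
    using W1 PQR(1) s(3) by algebra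
  moreover have "of_real w2 * Q * (V * p) = - (2 * l * v * (1 - w)^2 * (1 - u)^2 * (w - u))"
    using W2 PQR(2) s(3) by algebra
  moreover have "of_real w3 * R * (V * p) = - (2 * l * w * (1 - u)^2 * (1 - v)^2 * (u - v))"
    using W3 PQR(3) s(3) by algebra
  moreover have "u * (1 - v)^2 * (1 - w)^2 * (v - w) + v * (1 - w)^2 * (1 - u)^2 * (w - u)
     + w * (1 - u)^2 * (1 - v)^2 * (u - v) = - V * (2 - s + l)"
  proof -
    \<comment> \<open>With elementary symmetric e1, e2, e3, (1 - v)(1 - w) = (1 - e1 + e2) + (1 -
      e1)u + u^2. Squaring reduces the left side to the cyclic sums of u^n (v - w) for n = 1 to 5,
      which are -V times the complete homogeneous polynomials 0, 1, e1, e1^2 - e2, e1^3 - 2 e1 e2 +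
      e3.\<close>
    have "u * (1 - v)^2 * (1 - w)^2 * (v - w) + v * (1 - w)^2 * (1 - u)^2 * (w - u)
      + w * (1 - u)^2 * (1 - v)^2 * (u - v) =
      - V * (2 * (1 - (u + v + w) + (u * v + v * w + w * u)) * (1 - (u + v + w))
        + ((1 - (u + v + w))^2 + 2 * (1 - (u + v + w) + (u * v + v * w + w * u))) * (u + v + w)
        + 2 * (1 - (u + v + w)) * ((u + v + w)^2 - (u * v + v * w + w * u))
        + ((u + v + w)^3 - 2 * (u + v + w) * (u * v + v * w + w * u) + u * v * w))"
      unfolding V_def by algebra
    also have "\<dots> = - V * (2 - s + l)" unfolding s by algebra
    finally show ?thesis .
  qed
  ultimately have S: "(of_real w1 * P + of_real w2 * Q + of_real w3 * R) * (V * p) = 2 * l * V * (2 - s + l)"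
    by algebra
  have "((of_real w1 * P + of_real w2 * Q + of_real w3 * R) * D + of_real (w1 + w2 + w3) * (2 * (2 - s + l))) * (V * p) = 0"
    using S W by algebra
  hence "(of_real w1 * P + of_real w2 * Q + of_real w3 * R) * D = - of_real (w1 + w2 + w3) * (2 * (2 - s + l))"
    using VP by (metis add_eq_0_iff2 minus_mult_left mult_eq_0_iff)
  hence "(of_real w1 * P + of_real w2 * Q + of_real w3 * R) * D = of_real (w1 + w2 + w3) * (- 2 * (2 - s + l))"
    by algebra
  thus "of_real w1 * P + of_real w2 * Q + of_real w3 * R =
      of_real (w1 + w2 + w3) * (- 2 * (2 - s + l) / of_real (conj_denom s))"
    using D0 unfolding D_def[symmetric] times_divide_eq_right by (subst nonzero_eq_divide_eq)
qed

text \<open>The nine-point circle touches the unit circle at 1 from outside the disc it bounds, so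
  its centre \<open>N\<close> is real and its radius is 1 - N = 1 / (1 - |s|^2), half the
  circumradius. The squared distance condition is linear in \<open>N\<close>, which makes it a
  polynomial identity after clearing denominators.\<close>

lemma nine_point_midpoint:
  assumes un: "cmod u = 1" "cmod v = 1" "cmod w = 1"
    and nz: "v + w \<noteq> 0" "w + u \<noteq> 0" "u + v \<noteq> 0"
    and s: "u + v + w = s" "u * v + v * w + w * u = s"
    and s1: "cmod s < 1" and N: "N = - ((cmod s)^2 / (1 - (cmod s)^2))"
  shows "cmod ((2 * w * u / (w + u) + 2 * u * v / (u + v)) / 2 - of_real N) = 1 - N"
proof -
  define n where "n = (cmod s)^2"
  have n1: "n < 1" unfolding n_def using s1 by (simp add: abs_square_less_1)
  have N1: "N * (1 - n) = - n" using n1 unfolding N n_def[symmetric] by simp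
  have "N \<le> 0" using n1 unfolding N n_def[symmetric] by (simp add: n_def)
  define b c where "b = 1 / (w + u)" and "c = 1 / (u + v)"
  have bc: "b * (w + u) = 1" "c * (u + v) = 1"
    using nz by (auto simp: b_def c_def)
  define M where "M = (2 * w * u / (w + u) + 2 * u * v / (u + v)) / 2"
  have M: "M = w * u * b + u * v * c" by (simp add: M_def b_def c_def mult_ac)
  have "cnj M = (2 / (w + u) + 2 / (u + v)) / 2"
    unfolding M_def complex_cnj_divide[of _ 2] complex_cnj_add[of "2 * w * u / (w + u)"] cnj_tangent_vertex[OF un(3,1) nz(2)]
      cnj_tangent_vertex[OF un(1,2) nz(3)] by simp
  moreover have "2 / x / 2 = 1 / x" for x :: complex by simp
  ultimately have cM: "cnj M = b + c" by (simp only: b_def c_def add_divide_distrib)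
  define l where "l = u * v * w"
  have l0: "l \<noteq> 0" using un by (auto simp: l_def)
  define g where "g = (w + u) * (u + v)"
  have g0: "g \<noteq> 0" using nz by (simp add: g_def)
  have sl: "s = l * cnj s" using cnj_sum_unit[OF un] s by (simp add: l_def)
  have ln: "l * of_real n = s^2"
    unfolding n_def complex_norm_square using sl by algebra
  \<comment> \<open>Here \<open>g\<close> clears the denominators of \<open>M\<close> and
    \<open>cnj M\<close>, \<open>l\<close> turns |s|^2 into s^2, and the cubic equation satisfied by
    u eliminates l.\<close>
  have "l * ((1 - of_real n) * (M * cnj M - 1) + of_real n * (M + cnj M - 2)) * g = 0"
  proof -
    have g: "g = u^2 + s" unfolding g_def s(2)[symmetric] by algebra
    have "u * v * w = u^3 - (u + v + w) * u^2 + (u * v + v * w + w * u) * u" by algebra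
    hence lu: "l = u^3 - s * u^2 + s * u" unfolding s l_def[symmetric] .
    have Mg: "M * g = l + s * u" unfolding M g_def l_def using bc s by algebra
    have cMg: "cnj M * g = u + s" unfolding cM g_def using bc s by algebra
    have ls: "l - s^2 = - (s - u) * g" unfolding g lu by algebra
    have "l * ((1 - of_real n) * (M * cnj M - 1) + of_real n * (M + cnj M - 2)) * g
      = (l - s^2) * g * (M * cnj M - 1) + s^2 * (M * g + cnj M * g - 2 * g)" using ln by algebra
    also have "\<dots> = - (s - u) * ((M * g) * (cnj M * g) - g^2) + s^2 * (M * g + cnj M * g - 2 * g)"
      unfolding ls by algebra
    also have "\<dots> = 0" unfolding Mg cMg unfolding g lu by algebra
    finally show ?thesis .
  qed
  hence "(1 - of_real n) * (M * cnj M - 1) + of_real n * (M + cnj M - 2) = 0"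
    using g0 l0 by simp
  hence "complex_of_real ((1 - n) * ((cmod M)^2 - 1) + n * (2 * Re M - 2)) = 0"
    using complex_norm_square[of M] by (simp add: complex_add_cnj)
  hence "(1 - n) * ((cmod M)^2 - 1) + n * (2 * Re M - 2) = 0" using of_real_eq_0_iff by blast
  hence "(1 - n) * ((cmod M)^2 - 1 - N * (2 * Re M - 2)) = 0" using N1 by algebra
  hence 1: "(cmod M)^2 - 1 = N * (2 * Re M - 2)" using n1 by simp
  have "(cmod (M - of_real N))^2 = (cmod M)^2 - 2 * N * Re M + N^2"
    unfolding cmod_power2 by (simp add: algebra_simps power2_eq_square)
  also have "\<dots> = (1 - N)^2" using 1 by (simp add: algebra_simps power2_eq_square)
  finally show ?thesis unfolding M_def[symmetric] using \<open>N \<le> 0\<close> by (simp add: power2_eq_iff_nonneg)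
qed

lemma internally_tangent_circles:
  assumes N: "N < 0"
  shows "cmod z = 1 \<and> cmod (z - of_real N) = 1 - N \<longleftrightarrow> z = 1"
proof
  assume a: "cmod z = 1 \<and> cmod (z - of_real N) = 1 - N"
  have "(cmod (z - of_real N))^2 = (cmod z)^2 - 2 * N * Re z + N^2"
    unfolding cmod_power2 by (simp add: algebra_simps power2_eq_square)
  hence "N * (Re z - 1) = 0" using a by (simp add: algebra_simps power2_eq_square)
  hence "Re z = 1" using N by simp
  moreover have "Im z = 0" using a calculation cmod_power2[of z] by simp
  ultimately show "z = 1" by (simp add: complex_eq_iff)
next
  assume "z = 1"
  have "cmod (1 - of_real N) = \<bar>1 - N\<bar>" by (metis norm_of_real of_real_1 of_real_diff)
  thus "cmod z = 1 \<and> cmod (z - of_real N) = 1 - N" using N \<open>z = 1\<close> by simp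
qed

text \<open>The isogonal conjugate of the point \<open>1\<close> of the incircle with respect to the triangle whose
  points of contact have product \<open>l\<close> and sum \<open>k l + cnj k\<close>.\<close>

definition conj_point :: "complex \<Rightarrow> complex \<Rightarrow> complex" where
  "conj_point k l = - 2 * (2 - (k * l + cnj k) + l) / of_real (conj_denom (k * l + cnj k))"

text \<open>On the unit circle numerator and denominator are affine in x = Re l and y = Im l, so the
  cleared equation is a quadratic modulo x^2 + y^2 = 1. Its splitting gives containment and contact
  at once: 1 - Re l vanishes on the circle only at l = 1, and the other factor is positive for |k| <
  1.\<close>

lemma ellipse_form_conj_point:
  assumes l: "cmod l = 1" and D0': "conj_denom (k * l + cnj k) \<noteq> 0"
  shows "ellipse_form k (conj_point k l) * (conj_denom (k * l + cnj k))^2 =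
    - 16 * (1 - Re l) * (1 - Re (k * l))"
proof -
  obtain a b where k: "k = Complex a b" by (cases k)
  obtain x y where l': "l = Complex x y" by (cases l)
  have xy: "x^2 + y^2 = 1" using l unfolding l' by (simp add: cmod_def)
  define D where "D = conj_denom (k * l + cnj k)"
  define n1 n2 where "n1 = - 2 * (2 - (a * x - b * y + a) + x)" and "n2 = - 2 * (- (a * y + b * x - b) + y)"
  have "D = 3 - 4 * (a * x - b * y + a) + ((a * x - b * y + a)^2 + (a * y + b * x - b)^2)"
    by (simp add: D_def conj_denom_def k l' cmod_power2)
  also have "\<dots> = 3 - 4 * a + 2 * (a^2 + b^2) - 4 * (a * x - b * y) + 2 * ((a^2 - b^2) * x - 2 * a * b * y)"
    using xy by algebra
  finally have D: "D = 3 - 4 * a + 2 * (a^2 + b^2) - 4 * (a * x - b * y) + 2 * ((a^2 - b^2) * x - 2 * a * b * y)" .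
  have n: "- 2 * (2 - (k * l + cnj k) + l) = Complex n1 n2"
    by (simp add: complex_eq_iff k l' n1_def n2_def)
  have D0: "D \<noteq> 0" using D0' by (simp add: D_def)
  have q: "conj_point k l = Complex (n1 / D) (n2 / D)"
    unfolding conj_point_def n D_def[symmetric] by (simp add: complex_eq_iff Re_divide_of_real Im_divide_of_real)
  have "ellipse_form k (conj_point k l) * D^2 = n1^2 + n2^2 - 2 * (a * (n1^2 - n2^2) - b * (2 * n1 * n2)) + 4 * (a * n1 - b * n2) * D - 4 * D^2"
    unfolding ellipse_form_def q cmod_power2 using D0
    by (simp add: k power2_eq_square field_simps)
  also have "\<dots> = - 16 * (1 - x) * (1 - (a * x - b * y))"
    unfolding n1_def n2_def D using xy by algebra
  finally show ?thesis by (simp add: D_def k l')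
qed

section \<open>Uniqueness of incircle and nine-point circle\<close>

lemma det_zero_imp_collinear:
  fixes P Q R :: "real^2"
  assumes "(Q$1 - P$1) * (R$2 - P$2) = (Q$2 - P$2) * (R$1 - P$1)"
  shows "collinear {P, Q, R}"
proof (cases "P = Q")
  case False
  define n where "n = (Q$1 - P$1)^2 + (Q$2 - P$2)^2"
  define t where "t = ((R$1 - P$1) * (Q$1 - P$1) + (R$2 - P$2) * (Q$2 - P$2)) / n"
  have n: "n \<noteq> 0" using False by (auto simp: n_def vec_eq_iff forall_2 sum_power2_eq_zero_iff)
  have tn: "t * n = (R$1 - P$1) * (Q$1 - P$1) + (R$2 - P$2) * (Q$2 - P$2)" using n by (simp add: t_def)
  have "n * (R$1 - P$1 - t * (Q$1 - P$1)) = 0"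
    using tn assms unfolding n_def by algebra
  moreover have "n * (R$2 - P$2 - t * (Q$2 - P$2)) = 0"
    using tn assms unfolding n_def by algebra
  ultimately have "R = P + t *\<^sub>R (Q - P)"
    using n by (simp add: vec_eq_iff forall_2)
  hence "R \<in> affine hull {P, Q}" unfolding affine_hull_2_alt by blast
  thus ?thesis using collinear_3_affine_hull[OF False] by blast
qed (simp add: collinear_2)

lemma orthogonal_to_triangle_imp_zero:
  fixes P Q R n :: "real^2"
  assumes nc: "\<not> collinear {P, Q, R}" and o: "n \<bullet> (P - Q) = 0" "n \<bullet> (P - R) = 0"
  shows "n = 0"
proof -
  have d: "(Q$1 - P$1) * (R$2 - P$2) - (Q$2 - P$2) * (R$1 - P$1) \<noteq> 0"
    using det_zero_imp_collinear[of Q P R] nc by auto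
  have e: "n$1 * (P$1 - Q$1) + n$2 * (P$2 - Q$2) = 0" "n$1 * (P$1 - R$1) + n$2 * (P$2 - R$2) = 0"
    using o by (simp_all add: inner_vec_def sum_2)
  have "n$1 * ((Q$1 - P$1) * (R$2 - P$2) - (Q$2 - P$2) * (R$1 - P$1)) = 0" using e by algebra
  moreover have "n$2 * ((Q$1 - P$1) * (R$2 - P$2) - (Q$2 - P$2) * (R$1 - P$1)) = 0" using e by algebra
  ultimately show ?thesis using d by (simp add: vec_eq_iff forall_2)
qed

text \<open>The difference of the squared distances to two fixed points is an affine function of the
  moving point; it is constant on a triangle only if its gradient, a multiple of C - C', vanishes.
  This serves both the incircle and the nine-point circle.\<close>

lemma center_unique:
  fixes P Q R C C' :: "real^2"
  assumes nc: "\<not> collinear {P, Q, R}"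
    and e: "(dist P C)^2 - (dist P C')^2 = d" "(dist Q C)^2 - (dist Q C')^2 = d" "(dist R C)^2 - (dist R C')^2 = d"
  shows "C = C'"
proof -
  have *: "(C - C') \<bullet> (X - Y) = 0"
    if "(dist X C)^2 - (dist X C')^2 = d" "(dist Y C)^2 - (dist Y C')^2 = d" for X Y
    using that unfolding dist_norm power2_norm_eq_inner by (simp add: algebra_simps inner_commute)
  show ?thesis using orthogonal_to_triangle_imp_zero[OF nc *[OF e(1,2)] *[OF e(1,3)]] by simp
qed

lemma tangent_line_sphere_iff:
  fixes P Q C T :: "real^2"
  assumes "P \<noteq> Q"
  shows "tangent_line_at (affine hull {P, Q}) (sphere C r) T \<longleftrightarrow>
    T \<in> affine hull {P, Q} \<and> dist C T = r \<and> (T - C) \<bullet> (Q - P) = 0"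
proof -
  have norm_line: "(dist C (T + m *\<^sub>R (Q - P)))^2 = (dist C T)^2 + 2 * m * ((T - C) \<bullet> (Q - P)) + m^2 * ((Q - P) \<bullet> (Q - P))" for m
    unfolding dist_norm power2_norm_eq_inner by (simp add: algebra_simps inner_commute power2_eq_square)
  have on_line: "T + m *\<^sub>R (Q - P) \<in> affine hull {P, Q}" if "T \<in> affine hull {P, Q}" for m
  proof -
    from that obtain t where "T = P + t *\<^sub>R (Q - P)" unfolding affine_hull_2_alt by blast
    hence "T + m *\<^sub>R (Q - P) = P + (t + m) *\<^sub>R (Q - P)" by (simp add: algebra_simps)
    thus ?thesis unfolding affine_hull_2_alt by blast
  qed
  have pos: "(Q - P) \<bullet> (Q - P) > 0" using assms by simp
  have two: "\<exists>A B. A \<noteq> B \<and> affine hull {P, Q} = affine hull {A, B}" using assms by blast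
  show ?thesis unfolding tangent_line_at_def
  proof (intro iffI conjI two)
    assume a: "(\<exists>A B. A \<noteq> B \<and> affine hull {P, Q} = affine hull {A, B}) \<and> affine hull {P, Q} \<inter> sphere C r = {T}"
    thus 1: "T \<in> affine hull {P, Q}" "dist C T = r" by auto
    \<comment> \<open>\<open>T + m *\<^sub>R (Q - P)\<close> is the mirror image of \<open>T\<close>
      in the foot of the perpendicular from \<open>C\<close>, the potential second intersection with
      the circle.\<close>
    define m where "m = - 2 * ((T - C) \<bullet> (Q - P)) / ((Q - P) \<bullet> (Q - P))"
    have "(dist C (T + m *\<^sub>R (Q - P)))^2 = (dist C T)^2"
      unfolding norm_line using pos by (simp add: m_def field_simps power2_eq_square)
    hence "dist C (T + m *\<^sub>R (Q - P)) = r" using 1 by (metis power2_eq_imp_eq zero_le_dist)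
    hence "T + m *\<^sub>R (Q - P) \<in> affine hull {P, Q} \<inter> sphere C r" using on_line[OF 1(1)] by simp
    hence "T + m *\<^sub>R (Q - P) = T" using a by blast
    hence "m = 0" using assms by simp
    thus "(T - C) \<bullet> (Q - P) = 0" using pos by (simp add: m_def)
  next
    assume a: "T \<in> affine hull {P, Q} \<and> dist C T = r \<and> (T - C) \<bullet> (Q - P) = 0"
    have "X = T" if X: "X \<in> affine hull {P, Q}" "dist C X = r" for X
    proof -
      obtain t t' where t: "T = P + t *\<^sub>R (Q - P)" "X = P + t' *\<^sub>R (Q - P)"
        using a X unfolding affine_hull_2_alt by blast
      hence XT: "X = T + (t' - t) *\<^sub>R (Q - P)" unfolding t by (simp add: algebra_simps)
      have "(t' - t)^2 * ((Q - P) \<bullet> (Q - P)) = 0"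
        using norm_line[of "t' - t"] a X unfolding XT[symmetric] by simp
      thus ?thesis using pos XT by simp
    qed
    thus "affine hull {P, Q} \<inter> sphere C r = {T}" using a by auto
  qed
qed

lemma side_tangent_distinct:
  assumes "side_tangent P Q K"
  shows "P \<noteq> Q"
proof
  assume "P = Q"
  with assms obtain A B :: "real^2" where "A \<noteq> B" "{Q} = affine hull {A, B}"
    by (auto simp: side_tangent_def tangent_line_at_def)
  moreover have "A \<in> affine hull {A, B}" "B \<in> affine hull {A, B}" by (auto intro: hull_inc)
  ultimately show False by (metis singletonD)
qed

text \<open>By Pythagoras the square roots are the tangent lengths from the endpoints. They add up
  to the side, with no difference arising, because the contact point lies on the segment; this
  separates the incircle from the excircles.\<close>

lemma side_tangent_length:
  fixes P Q C :: "real^2"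
  assumes "side_tangent P Q (sphere C r)"
  shows "r^2 \<le> (dist P C)^2"
    "sqrt ((dist P C)^2 - r^2) + sqrt ((dist Q C)^2 - r^2) = dist P Q"
proof -
  note PQ = side_tangent_distinct[OF assms]
  obtain T where T: "T \<in> closed_segment P Q" "dist C T = r" "(T - C) \<bullet> (Q - P) = 0"
    using assms unfolding side_tangent_def tangent_line_sphere_iff[OF PQ] by blast
  obtain t where t: "T = P + t *\<^sub>R (Q - P)"
    using T(1) by (auto simp: closed_segment_def algebra_simps)
  have "(T - C) \<bullet> (T - P) = 0" using T(3) by (simp add: t)
  moreover have "T - Q = (t - 1) *\<^sub>R (Q - P)" by (simp add: t algebra_simps)
  hence "(T - C) \<bullet> (T - Q) = 0" using T(3) by simp
  moreover have "(dist X C)^2 - r^2 = (dist X T)^2" if "(T - C) \<bullet> (T - X) = 0" for X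
    using that unfolding T(2)[symmetric] dist_norm power2_norm_eq_inner
    by (simp add: algebra_simps inner_commute)
  ultimately have *: "(dist P C)^2 - r^2 = (dist P T)^2" "(dist Q C)^2 - r^2 = (dist Q T)^2" by auto
  show "r^2 \<le> (dist P C)^2" using * zero_le_power2[of "dist P T"] by linarith
  have "dist P T + dist T Q = dist P Q"
    using T(1) between_mem_segment between by metis
  thus "sqrt ((dist P C)^2 - r^2) + sqrt ((dist Q C)^2 - r^2) = dist P Q"
    unfolding * by (simp add: dist_commute)
qed

text \<open>The pairwise sums of the three tangent lengths are the side lengths, so each tangent
  length is determined by the triangle. Two candidates then have squared distances to the vertices
  that differ by a constant.\<close>

lemma incircle_unique:
  assumes nc: "\<not> collinear {P, Q, R}"
    and i: "is_incircle P Q R C r" "is_incircle P Q R C' r'"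
  shows "C = C'" "r = r'"
proof -
  define len where "len C r X = sqrt ((dist X C)^2 - r^2)" for C :: "real^2" and r X
  have L: "len C r P + len C r Q = dist P Q" "len C r Q + len C r R = dist Q R" "len C r R + len C r P = dist R P"
     "r^2 \<le> (dist P C)^2" "r^2 \<le> (dist Q C)^2" "r^2 \<le> (dist R C)^2" if "is_incircle P Q R C r" for C r
    using that side_tangent_length[of P Q C r] side_tangent_length[of Q R C r] side_tangent_length[of R P C r]
    unfolding is_incircle_def len_def by blast+
  have eq: "len C r P = len C' r' P" "len C r Q = len C' r' Q" "len C r R = len C' r' R"
    using L(1-3)[OF i(1)] L(1-3)[OF i(2)] by linarith+
  have d: "(dist P C)^2 - (dist P C')^2 = r^2 - r'^2" "(dist Q C)^2 - (dist Q C')^2 = r^2 - r'^2"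
     "(dist R C)^2 - (dist R C')^2 = r^2 - r'^2"
    using eq L(4-6)[OF i(1)] L(4-6)[OF i(2)] unfolding len_def by auto
  show C: "C = C'" by (rule center_unique[OF nc d])
  have "r^2 = r'^2" using d C by simp
  thus "r = r'" using i by (auto simp: is_incircle_def power2_eq_iff_nonneg)
qed

lemma nine_point_circle_unique:
  assumes nc: "\<not> collinear {P, Q, R}"
    and i: "is_nine_point_circle P Q R N s" "is_nine_point_circle P Q R N' s'"
  shows "N = N'" "s = s'"
proof -
  have d: "(dist M N)^2 - (dist M N')^2 = s^2 - s'^2"
    if "M \<in> {midpoint P Q, midpoint Q R, midpoint R P}" for M
    using i that unfolding is_nine_point_circle_def by (auto simp: dist_commute)
  have nc': "\<not> collinear {midpoint P Q, midpoint Q R, midpoint R P}"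
  proof
    assume c: "collinear {midpoint P Q, midpoint Q R, midpoint R P}"
    obtain u where u: "\<And>x y. x \<in> {midpoint P Q, midpoint Q R, midpoint R P} \<Longrightarrow>
        y \<in> {midpoint P Q, midpoint Q R, midpoint R P} \<Longrightarrow> \<exists>c. x - y = c *\<^sub>R u"
      using c unfolding collinear_def by metis
    have "P - Q = 2 *\<^sub>R (midpoint R P - midpoint Q R)" "P - R = 2 *\<^sub>R (midpoint P Q - midpoint Q R)"
      by (simp_all add: midpoint_def vec_eq_iff field_simps)
    moreover obtain c d where "midpoint R P - midpoint Q R = c *\<^sub>R u" "midpoint P Q - midpoint Q R = d *\<^sub>R u"
      using u[of "midpoint R P" "midpoint Q R"] u[of "midpoint P Q" "midpoint Q R"] by blast
    ultimately have cd: "P - Q = (2 * c) *\<^sub>R u" "P - R = (2 * d) *\<^sub>R u" by simp_all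
    have "Q$i = P$i - 2 * c * u$i" "R$i = P$i - 2 * d * u$i" for i
      using cd by (auto simp: vec_eq_iff algebra_simps)
    hence "(Q$1 - P$1) * (R$2 - P$2) = (Q$2 - P$2) * (R$1 - P$1)" by simp
    thus False using det_zero_imp_collinear nc by blast
  qed
  show N: "N = N'" by (rule center_unique[OF nc' d d d]) auto
  have "s^2 = s'^2" using d[of "midpoint P Q"] N by simp
  thus "s = s'" using i by (auto simp: is_nine_point_circle_def power2_eq_iff_nonneg)
qed

section \<open>Projective images of the circle\<close>

definition vec2 :: "complex \<Rightarrow> real^2" where
  "vec2 z = vector [Re z, Im z]"

text \<open>An orientation-preserving similarity for nonzero \<open>f\<close>. In the application
  the unit circle goes to the incircle about \<open>C\<close>, and \<open>f\<close> is the vector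
  from \<open>C\<close> to Feuerbach's point.\<close>

definition frame :: "real^2 \<Rightarrow> complex \<Rightarrow> complex \<Rightarrow> real^2" where
  "frame C f z = C + vec2 (f * z)"

lemma vec2_nth [simp]: "vec2 z $ 1 = Re z" "vec2 z $ 2 = Im z"
  by (simp_all add: vec2_def)

lemma vec2_linear: "vec2 (z + w) = vec2 z + vec2 w" "vec2 (z - w) = vec2 z - vec2 w"
  "vec2 (of_real t * z) = t *\<^sub>R vec2 z" "vec2 0 = 0"
  by (simp_all add: vec_eq_iff forall_2)

lemma inner_vec2: "vec2 z \<bullet> vec2 w = Re (z * cnj w)"
  by (simp add: inner_vec_def sum_2)

lemma norm_vec2 [simp]: "norm (vec2 z) = cmod z"
  by (simp add: norm_eq_sqrt_inner[of "vec2 z"] inner_vec2 cmod_def power2_eq_square)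

lemma frame_diff: "frame C f z - frame C f w = vec2 (f * (z - w))"
  by (simp add: frame_def right_diff_distrib vec2_linear)

lemma frame_minus_center: "frame C f z - C = vec2 (f * z)"
  by (simp add: frame_def)

lemma frame_0 [simp]: "frame C f 0 = C"
  by (simp add: frame_def vec2_linear)

lemma dist_frame: "dist (frame C f z) (frame C f w) = cmod f * cmod (z - w)"
  by (simp add: dist_norm frame_diff norm_mult)

lemma frame_eq_iff: "f \<noteq> 0 \<Longrightarrow> frame C f z = frame C f w \<longleftrightarrow> z = w"
  using dist_frame[of C f z w] by (metis dist_eq_0_iff mult_eq_0_iff norm_eq_zero right_minus_eq)

lemma frame_surj: 
  assumes "f \<noteq> 0" obtains z where "X = frame C f z"
proof
  show "X = frame C f (Complex ((X - C) $ 1) ((X - C) $ 2) / f)"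
    using assms by (simp add: frame_def vec_eq_iff forall_2)
qed

lemma frame_affine: "frame C f (z + of_real t * (w - z)) = frame C f z + t *\<^sub>R (frame C f w - frame C f z)"
proof -
  have "f * (z + of_real t * (w - z)) = f * z + of_real t * (f * (w - z))" by (simp add: algebra_simps)
  thus ?thesis unfolding frame_diff by (simp add: frame_def vec2_linear)
qed

lemma frame_barycentric:
  assumes "z1 + z2 + z3 = 1"
  shows "z1 *\<^sub>R frame C f P + z2 *\<^sub>R frame C f Q + z3 *\<^sub>R frame C f R =
    frame C f (of_real z1 * P + of_real z2 * Q + of_real z3 * R)"
proof -
  have C: "z1 *\<^sub>R C + z2 *\<^sub>R C + z3 *\<^sub>R C = C"
    using assms by (metis scaleR_add_left scaleR_one)
  have e: "f * (of_real z1 * P + of_real z2 * Q + of_real z3 * R) =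
     of_real z1 * (f * P) + of_real z2 * (f * Q) + of_real z3 * (f * R)" by (simp add: algebra_simps)
  have "z1 *\<^sub>R frame C f P + z2 *\<^sub>R frame C f Q + z3 *\<^sub>R frame C f R =
    (z1 *\<^sub>R C + z2 *\<^sub>R C + z3 *\<^sub>R C) + (z1 *\<^sub>R vec2 (f * P) + z2 *\<^sub>R vec2 (f * Q) + z3 *\<^sub>R vec2 (f * R))"
    unfolding frame_def scaleR_add_right by simp
  thus ?thesis unfolding C frame_def e vec2_linear .
qed

lemma affine_hull_frame:
  "affine hull {frame C f z, frame C f w} = range (\<lambda>t. frame C f (z + of_real t * (w - z)))"
  unfolding affine_hull_2_alt frame_affine ..

text \<open>Every real quadratic form of a complex variable is h |q|^2 + Re (\<mu> q^2). The
  rotation \<open>w\<close> with \<mu> w^2 = |\<mu>| diagonalizes it, with eigenvalues h + |\<mu>|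
  and h - |\<mu>|, and completing the square yields the centre. Two distinct points exclude the
  empty set and a single point.\<close>

lemma quadratic_locus_is_ellipse:
  fixes h F :: real and \<mu> \<nu> :: complex
  assumes f: "f \<noteq> 0"
    and pos: "\<And>q. q \<noteq> 0 \<Longrightarrow> h * (cmod q)^2 + Re (\<mu> * q^2) > 0"
    and S: "S = {q. h * (cmod q)^2 + Re (\<mu> * q^2) + Re (\<nu> * q) + F = 0}"
    and two: "q1 \<in> S" "q2 \<in> S" "q1 \<noteq> q2"
  shows "is_ellipse (frame C f ` S)"
proof -
  obtain w where w: "cmod w = 1" "\<mu> * w^2 = of_real (cmod \<mu>)"
  proof (cases "\<mu> = 0")
    case False
    define w where "w = csqrt (of_real (cmod \<mu>) / \<mu>)"
    have w2: "w^2 = of_real (cmod \<mu>) / \<mu>" by (simp add: w_def)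
    hence "(cmod w)^2 = 1" using False by (simp add: norm_power[symmetric] norm_divide)
    hence "cmod w = 1" by (metis abs_norm_cancel abs_square_eq_1)
    thus ?thesis using that w2 False by simp
  qed (use that[of 1] in simp)
  have w0: "w \<noteq> 0" using w by auto
  define p m where "p = h + cmod \<mu>" and "m = h - cmod \<mu>"
  have "p > 0" using pos[of w] w w0 by (simp add: p_def)
  moreover have "m > 0"
  proof -
    have "\<mu> * (w * \<i>)^2 = - (\<mu> * w^2)" by (simp add: power_mult_distrib)
    thus ?thesis using pos[of "w * \<i>"] w w0 by (simp add: m_def norm_mult)
  qed
  ultimately have pm: "p > 0" "m > 0" .
  define \<alpha> \<beta> where "\<alpha> = Re (\<nu> * w) / (2 * p)" and "\<beta> = - Im (\<nu> * w) / (2 * m)"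
  define K where "K = p * \<alpha>^2 + m * \<beta>^2 - F"
  define z0 where "z0 = Complex (- \<alpha>) (- \<beta>)"
  have form: "h * (cmod (w * z))^2 + Re (\<mu> * (w * z)^2) + Re (\<nu> * (w * z)) + F =
     p * (Re z - Re z0)^2 + m * (Im z - Im z0)^2 - K" for z
  proof -
    have "\<mu> * (w * z)^2 = of_real (cmod \<mu>) * z^2" using w(2) by (simp add: power_mult_distrib mult.assoc[symmetric])
    hence 1: "Re (\<mu> * (w * z)^2) = cmod \<mu> * ((Re z)^2 - (Im z)^2)" by (simp add: Re_power2)
    have 2: "(cmod (w * z))^2 = (Re z)^2 + (Im z)^2" using w by (simp add: norm_mult cmod_power2)
    have 3: "Re (\<nu> * (w * z)) = 2 * p * \<alpha> * Re z + 2 * m * \<beta> * Im z"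
      using pm by (simp add: \<alpha>_def \<beta>_def mult.assoc[symmetric]) (simp add: algebra_simps)
    show ?thesis unfolding 1 2 3 K_def z0_def p_def m_def by (simp add: algebra_simps power2_eq_square)
  qed
  have mem: "w * z \<in> S \<longleftrightarrow> p * (Re z - Re z0)^2 + m * (Im z - Im z0)^2 = K" for z
    using form[of z] unfolding S by auto
  have "K > 0"
  proof (rule ccontr)
    assume "\<not> K > 0"
    have "z = z0" if "w * z \<in> S" for z
    proof -
      have "p * (Re z - Re z0)^2 + m * (Im z - Im z0)^2 \<le> 0" using that \<open>\<not> K > 0\<close> mem by auto
      moreover have "p * (Re z - Re z0)^2 \<ge> 0" "m * (Im z - Im z0)^2 \<ge> 0" using pm by auto
      ultimately have "p * (Re z - Re z0)^2 = 0" "m * (Im z - Im z0)^2 = 0" by linarith+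
      thus ?thesis using pm by (simp add: complex_eq_iff)
    qed
    from this[of "q1 / w"] this[of "q2 / w"] show False using two w0 by simp
  qed
  define u v where "u = vec2 (f * w / of_real (cmod f))" and "v = vec2 (\<i> * f * w / of_real (cmod f))"
  define A B where "A = cmod f * sqrt (K / p)" and "B = cmod f * sqrt (K / m)"
  have AB: "A > 0" "B > 0" using f \<open>K > 0\<close> pm by (auto simp: A_def B_def)
  have uv: "norm u = 1" "norm v = 1" "u \<bullet> v = 0"
    using f w by (simp_all add: u_def v_def norm_mult norm_divide inner_vec2 algebra_simps)
  have cf: "Re (f * (w * z) * cnj (x * f * w / of_real (cmod f))) = cmod f * Re (z * cnj x)" for z x
  proof -
    have "f * (w * z) * cnj (x * f * w / of_real (cmod f)) = (f * cnj f) * (w * cnj w) * (z * cnj x) / of_real (cmod f)"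
      by (simp add: field_simps)
    also have "\<dots> = of_real (cmod f) * (z * cnj x)"
      unfolding complex_norm_square[symmetric] using w f by (simp add: power2_eq_square)
    finally show ?thesis by simp
  qed
  have coord: "(frame C f (w * z) - frame C f (w * z0)) \<bullet> u = cmod f * (Re z - Re z0)"
    "(frame C f (w * z) - frame C f (w * z0)) \<bullet> v = cmod f * (Im z - Im z0)" for z
    unfolding frame_diff u_def v_def inner_vec2 using cf[of "z - z0" 1] cf[of "z - z0" \<i>]
    by (simp_all add: right_diff_distrib)
  have "frame C f ` S = {X. ((X - frame C f (w * z0)) \<bullet> u)^2 / A^2 + ((X - frame C f (w * z0)) \<bullet> v)^2 / B^2 = 1}"
    (is "_ = ?E")
  proof -
    have iff: "frame C f (w * z) \<in> ?E \<longleftrightarrow> w * z \<in> S" for z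
    proof -
      have "(cmod f * x)^2 / A^2 = p * x^2 / K" "(cmod f * x)^2 / B^2 = m * x^2 / K" for x
        using f pm \<open>K > 0\<close> by (simp_all add: A_def B_def power_mult_distrib)
      hence "frame C f (w * z) \<in> ?E \<longleftrightarrow> p * (Re z - Re z0)^2 / K + m * (Im z - Im z0)^2 / K = 1"
        unfolding mem_Collect_eq coord by simp
      also have "\<dots> \<longleftrightarrow> w * z \<in> S" unfolding mem using \<open>K > 0\<close> by (auto simp add: add_divide_distrib[symmetric])
      finally show ?thesis .
    qed
    show ?thesis
    proof (intro equalityI subsetI)
      fix X assume "X \<in> frame C f ` S"
      then obtain q where "q \<in> S" "X = frame C f (w * (q / w))" using w0 by auto
      thus "X \<in> ?E" using iff[of "q / w"] w0 by simp
    next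
      fix X assume X: "X \<in> ?E"
      obtain q where "X = frame C f (w * (q / w))" using frame_surj[OF f, of X C] w0 by auto
      thus "X \<in> frame C f ` S" using iff[of "q / w"] X w0 by auto
    qed
  qed
  thus ?thesis unfolding is_ellipse_def using AB uv by blast
qed

section \<open>The image of the unit circle under a projective map is an ellipse\<close>

lemma Re_real_mult: "Re (of_real t * z) = t * Re z"
  by simp

text \<open>The denominator can be recovered from the image point: 1 - 2 Re (e x / M) is
  \<open>c0\<close> divided by it. Hence the inverse map is projective too, and |l| = 1 becomes a
  quadratic equation in x. The constant \<open>c0\<close> is the denominator at the zero -N/M of the
  numerator, and \<open>c0 \<noteq> 0\<close> is the nondegeneracy of the map.\<close>

lemma projective_circle_inverse:
  fixes e N M :: complex and d0 c0 :: real
  assumes M: "M \<noteq> 0" and D: "2 * cmod e < \<bar>d0\<bar>"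
    and c0: "c0 = d0 - 2 * Re (e * N / M)" "c0 \<noteq> 0"
  defines "q \<equiv> \<lambda>l. (N + M * l) / of_real (d0 + 2 * Re (e * l))"
  shows "cmod l = 1 \<Longrightarrow> d0 + 2 * Re (e * l) \<noteq> 0"
    and "cmod l = 1 \<Longrightarrow> (1 - 2 * Re (e * q l / M)) * (d0 + 2 * Re (e * l)) = c0"
    and "inj_on q {l. cmod l = 1}"
    and "q ` {l. cmod l = 1} = {x. (cmod (of_real c0 * x - of_real (1 - 2 * Re (e * x / M)) * N))^2
       = (cmod M)^2 * (1 - 2 * Re (e * x / M))^2}" (is "_ = ?S")
proof -
  have nz: "d0 + 2 * Re (e * l) \<noteq> 0" if "cmod l \<le> 1" for l
  proof -
    have "\<bar>Re (e * l)\<bar> \<le> cmod e" using abs_Re_le_cmod[of "e * l"] that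
      by (metis mult_left_le norm_ge_zero norm_mult order_trans)
    thus ?thesis using D by auto
  qed
  thus nz': "cmod l = 1 \<Longrightarrow> d0 + 2 * Re (e * l) \<noteq> 0" for l by simp
  show g: "(1 - 2 * Re (e * q l / M)) * (d0 + 2 * Re (e * l)) = c0" if l: "cmod l = 1" for l
  proof -
    define d where "d = d0 + 2 * Re (e * l)"
    have d: "d \<noteq> 0" using nz' l by (simp add: d_def)
    have "e * q l / M = of_real (1 / d) * (e * N / M + e * l)"
      unfolding q_def d_def[symmetric] using M d by (simp add: field_simps)
    hence "Re (e * q l / M) = (1 / d) * (Re (e * N / M) + Re (e * l))"
      by (simp only: Re_real_mult plus_complex.simps)
    hence "Re (e * q l / M) * d = Re (e * N / M) + Re (e * l)" using d by simp
    thus ?thesis unfolding d_def[symmetric] c0(1) by (simp add: algebra_simps d_def)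
  qed
  show "inj_on q {l. cmod l = 1}"
  proof (intro inj_onI, unfold mem_Collect_eq)
    fix l l' assume l: "cmod l = 1" "cmod l' = 1" and eq: "q l = q l'"
    have "d0 + 2 * Re (e * l) = d0 + 2 * Re (e * l')"
      using g[OF l(1)] g[OF l(2)] c0(2) unfolding eq by (metis mult_cancel_left mult_zero_left)
    thus "l = l'" using eq nz'[OF l(1)] nz'[OF l(2)] M unfolding q_def
      by (metis add_left_cancel divide_cancel_right mult_cancel_left of_real_eq_0_iff)
  qed
  show "q ` {l. cmod l = 1} = ?S"
  proof (intro equalityI subsetI)
    fix x assume "x \<in> q ` {l. cmod l = 1}"
    then obtain l where l: "cmod l = 1" "x = q l" by auto
    define d where "d = d0 + 2 * Re (e * l)"
    define g' where "g' = 1 - 2 * Re (e * x / M)"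
    have d: "d \<noteq> 0" using nz' l by (simp add: d_def)
    have gd: "g' * d = c0" using g[OF l(1)] by (simp add: g'_def d_def l)
    have "x * of_real d = N + M * l" using d unfolding l q_def d_def[symmetric] by simp
    hence "of_real c0 * x - of_real g' * N = of_real g' * (M * l)"
      unfolding gd[symmetric] of_real_mult by algebra
    hence "cmod (of_real c0 * x - of_real g' * N) = \<bar>g'\<bar> * cmod M" using l by (simp add: norm_mult)
    thus "x \<in> ?S" unfolding mem_Collect_eq g'_def[symmetric] by (simp add: power_mult_distrib)
  next
    fix x assume "x \<in> ?S"
    define g' where "g' = 1 - 2 * Re (e * x / M)"
    have "(cmod (of_real c0 * x - of_real g' * N))^2 = (cmod M * \<bar>g'\<bar>)^2"
      using \<open>x \<in> ?S\<close> unfolding mem_Collect_eq g'_def[symmetric] by (simp add: power_mult_distrib)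
    hence n: "cmod (of_real c0 * x - of_real g' * N) = cmod M * \<bar>g'\<bar>" by (simp add: power2_eq_iff_nonneg)
    have g': "g' \<noteq> 0"
    proof
      assume "g' = 0"
      hence "x = 0" using n c0(2) by simp
      thus False using \<open>g' = 0\<close> by (simp add: g'_def)
    qed
    define d where "d = c0 / g'"
    have d: "d \<noteq> 0" "g' * d = c0" using c0(2) g' by (auto simp: d_def)
    define l where "l = (of_real d * x - N) / M"
    have Ml: "N + M * l = of_real d * x" using M by (simp add: l_def)
    have "of_real c0 * x - of_real g' * N = of_real g' * (M * l)"
      using Ml d(2) by (metis add_diff_cancel_left' mult.assoc of_real_mult right_diff_distrib')
    hence "cmod M * \<bar>g'\<bar> * cmod l = cmod M * \<bar>g'\<bar>" using n by (simp add: norm_mult mult_ac)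
    hence l1: "cmod l = 1" using M g' by simp
    have "e * l = of_real d * (e * x / M) - e * N / M" by (simp add: l_def right_diff_distrib diff_divide_distrib mult_ac)
    hence "Re (e * l) = d * Re (e * x / M) - Re (e * N / M)" by (simp only: Re_real_mult minus_complex.simps)
    hence "d0 + 2 * Re (e * l) = d" using d(2) c0(1) by (simp add: g'_def algebra_simps)
    hence "x = q l" unfolding q_def using Ml d(1) by simp
    thus "x \<in> q ` {l. cmod l = 1}" using l1 by simp
  qed
qed

text \<open>Here \<open>h\<close>, \<mu>, \<nu> and \<open>j\<close> are the coefficients of the
  quadratic equation of the image. That the conic is an ellipse amounts to definiteness of the
  leading form; injectivity supplies two distinct points.\<close>

lemma projective_circle_is_ellipse:
  fixes e N M :: complex and d0 c0 :: real
  assumes f: "f \<noteq> 0" and M: "M \<noteq> 0" and D: "2 * cmod e < \<bar>d0\<bar>"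
    and c0: "c0 = d0 - 2 * Re (e * N / M)" "c0 \<noteq> 0"
  shows "is_ellipse (frame C f ` (\<lambda>l. (N + M * l) / of_real (d0 + 2 * Re (e * l))) ` {l. cmod l = 1})"
proof -
  define q where "q = (\<lambda>l. (N + M * l) / of_real (d0 + 2 * Re (e * l)))"
  note inv = projective_circle_inverse[OF M D c0, folded q_def]
  define \<eta> where "\<eta> = e / M"
  define j where "j = (cmod N)^2 - (cmod M)^2"
  define h where "h = c0^2 + 2 * c0 * Re (\<eta> * N) + 2 * j * (cmod \<eta>)^2"
  define \<mu> where "\<mu> = 2 * of_real c0 * \<eta> * cnj N + 2 * of_real j * \<eta>^2"
  define \<nu> where "\<nu> = - 2 * of_real c0 * cnj N - 4 * of_real j * \<eta>"
  have quad: "(cmod (of_real c0 * x + of_real (2 * Re (\<eta> * x)) * N))^2 - (cmod M)^2 * (2 * Re (\<eta> * x))^2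
     = h * (cmod x)^2 + Re (\<mu> * x^2)" for x
    unfolding h_def \<mu>_def j_def cmod_power2 
    by (cases x; cases \<eta>; cases N; cases M) (simp add: algebra_simps power2_eq_square)
  have full: "(cmod (of_real c0 * x - of_real (1 - 2 * Re (\<eta> * x)) * N))^2 - (cmod M)^2 * (1 - 2 * Re (\<eta> * x))^2
     = h * (cmod x)^2 + Re (\<mu> * x^2) + Re (\<nu> * x) + j" for x
    unfolding h_def \<mu>_def \<nu>_def j_def cmod_power2 
    by (cases x; cases \<eta>; cases N; cases M) (simp add: algebra_simps power2_eq_square)
  \<comment> \<open>Otherwise the denominator would vanish somewhere in the closed unit disc.\<close>
  have pos: "h * (cmod x)^2 + Re (\<mu> * x^2) > 0" if x: "x \<noteq> 0" for x
  proof (rule ccontr)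
    define t where "t = 2 * Re (\<eta> * x)"
    assume "\<not> ?thesis"
    hence "(cmod (of_real c0 * x + of_real t * N))^2 \<le> (cmod M * \<bar>t\<bar>)^2"
      unfolding quad[symmetric] t_def by (simp add: power_mult_distrib)
    hence le: "cmod (of_real c0 * x + of_real t * N) \<le> cmod M * \<bar>t\<bar>"
      by (simp add: power2_le_iff_abs_le)
    have t: "t \<noteq> 0" using le x c0(2) by auto
    \<comment> \<open>This parameter is sent to infinity in the direction of x: N + M l is a real
      multiple of x while the denominator vanishes.\<close>
    define l where "l = - ((of_real c0 * x + of_real t * N) / (M * of_real t))"
    have "cmod l \<le> 1" using le M t by (simp add: l_def norm_divide norm_mult)
    have "e * l = - of_real (c0 / t) * (\<eta> * x) - e * N / M"
      using M t by (simp add: l_def \<eta>_def field_simps)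
    hence "Re (e * l) = - (c0 / t) * Re (\<eta> * x) - Re (e * N / M)"
      by (simp add: Re_divide_of_real)
    moreover have "(c0 / t) * Re (\<eta> * x) = c0 / 2"
    proof -
      have "(c0 / t) * (t / 2) = c0 / 2" using t by simp
      thus ?thesis by (simp only: t_def nonzero_mult_div_cancel_left)
    qed
    ultimately have "2 * Re (e * l) = - c0 - 2 * Re (e * N / M)" by linarith
    hence "d0 + 2 * Re (e * l) = 0" using c0(1) by simp
    moreover have "\<bar>Re (e * l)\<bar> \<le> cmod e" using abs_Re_le_cmod[of "e * l"] \<open>cmod l \<le> 1\<close>
      by (metis mult_left_le norm_ge_zero norm_mult order_trans)
    ultimately show False using D by linarith
  qed
  have S: "q ` {l. cmod l = 1} = {x. h * (cmod x)^2 + Re (\<mu> * x^2) + Re (\<nu> * x) + j = 0}"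
    unfolding inv(4) full[symmetric] by (simp add: \<eta>_def)
  have two: "q 1 \<in> q ` {l. cmod l = 1}" "q (-1) \<in> q ` {l. cmod l = 1}" by auto
  have ne: "q 1 \<noteq> q (-1)" using inj_onD[OF inv(3), of 1 "-1"] by auto
  show ?thesis unfolding q_def[symmetric]
    by (rule quadratic_locus_is_ellipse[OF f _ S two ne]) (rule pos)
qed

section \<open>The Poncelet family\<close>

lemma ellipse_form_line:
  "ellipse_form k (z + of_real t * d) = ellipse_form k z +
    t * Re ((2 * cnj z - 4 * k * z + 4 * k) * d) + t^2 * ((cmod d)^2 - 2 * Re (k * d^2))"
  unfolding ellipse_form_def cmod_power2 by (simp add: algebra_simps power2_eq_square)

text \<open>The bound 1/2 on |k| is what makes the leading part of \<open>ellipse_form\<close>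
  positive definite, so that the form is strictly convex along every line.\<close>

lemma dominated_quadratic_pos:
  assumes "cmod k < 1 / 2" "d \<noteq> 0"
  shows "(cmod d)^2 - 2 * Re (k * d^2) > 0"
proof -
  have "2 * Re (k * d^2) \<le> 2 * cmod k * (cmod d)^2"
    using complex_Re_le_cmod[of "k * d^2"] by (simp add: norm_mult norm_power)
  also have "\<dots> < 1 * (cmod d)^2" using assms by (intro mult_strict_right_mono) auto
  finally show ?thesis by simp
qed

lemma real_ratio_on_tangent:
  assumes w: "cmod w = 1" and P: "Re (P * cnj w) = 1" and Q: "Re (Q * cnj w) = 1" and "P \<noteq> Q"
  obtains t where "w = P + of_real t * (Q - P)"
proof -
  define p q where "p = Im (P * cnj w)" and "q = Im (Q * cnj w)"
  have w0: "cnj w * w = 1" using complex_norm_square[of w] w by (simp add: mult.commute)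
  have "P * cnj w = 1 + \<i> * of_real p" "Q * cnj w = 1 + \<i> * of_real q"
    using P Q by (auto simp: complex_eq_iff p_def q_def)
  hence PQ': "P = (1 + \<i> * of_real p) * w" "Q = (1 + \<i> * of_real q) * w"
    using w0 by (metis mult.assoc mult.right_neutral)+
  hence pq: "p \<noteq> q" using \<open>P \<noteq> Q\<close> by auto
  define t where "t = p / (p - q)"
  have t: "t * (q - p) = - p" using pq by (simp add: t_def field_simps)
  have "P + of_real t * (Q - P) = (1 + \<i> * of_real p + \<i> * of_real (t * (q - p))) * w"
    unfolding PQ' by (simp add: algebra_simps)
  also have "\<dots> = w" unfolding t by simp
  finally show ?thesis using that by metis
qed

lemma vertex_on_tangents:
  assumes "cmod v = 1" "cmod w = 1" "v + w \<noteq> 0"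
  shows "Re (2 * v * w / (v + w) * cnj v) = 1" "Re (2 * v * w / (v + w) * cnj w) = 1"
proof -
  have *: "Re (2 * x * y / (x + y) * cnj y) = 1" if a: "cmod x = 1" "cmod y = 1" "x + y \<noteq> 0" for x y
  proof -
    have y0: "y \<noteq> 0" using a by auto
    have "2 * x * y / (x + y) * cnj y = 2 * x / (x + y)" using y0 by (simp add: unit_cnj[OF a(2)])
    moreover have "cnj (2 * x * y / (x + y) * cnj y) = 2 * y / (x + y)"
      unfolding complex_cnj_mult[of _ "cnj y"] cnj_tangent_vertex[OF a] by simp
    moreover have "2 * x / (x + y) + 2 * y / (x + y) = 2"
      using a(3) by (metis add_divide_distrib distrib_left nonzero_mult_div_cancel_right)
    ultimately have "complex_of_real (2 * Re (2 * x * y / (x + y) * cnj y)) = of_real 2"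
      using complex_add_cnj[of "2 * x * y / (x + y) * cnj y"] by (simp only:) simp
    thus ?thesis unfolding of_real_eq_iff by linarith
  qed
  show "Re (2 * v * w / (v + w) * cnj w) = 1" by (rule *[OF assms])
  show "Re (2 * v * w / (v + w) * cnj v) = 1"
    using *[of w v] assms by (simp add: add.commute mult_ac)
qed

lemma side_tangent_frame:
  assumes f: "f \<noteq> 0" and \<tau>: "\<tau> > 0"
    and st: "side_tangent (frame C f P) (frame C f Q) (sphere C (\<tau> * cmod f))"
  obtains t where "cmod t = 1" "Re (P * cnj t) = \<tau>" "Re (Q * cnj t) = \<tau>"
proof -
  note ne = side_tangent_distinct[OF st]
  obtain T where T: "T \<in> affine hull {frame C f P, frame C f Q}" "dist C T = \<tau> * cmod f"
    "(T - C) \<bullet> (frame C f Q - frame C f P) = 0"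
    using st unfolding side_tangent_def tangent_line_sphere_iff[OF ne] by blast
  obtain x y where xy: "T = frame C f y" "y = P + of_real x * (Q - P)"
    using T(1) unfolding affine_hull_frame by auto
  have y: "cmod y = \<tau>" using T(2) dist_frame[of C f 0 y] f by (simp add: xy(1))
  have "(T - C) \<bullet> (frame C f Q - frame C f P) = Re (f * y * cnj (f * (Q - P)))"
    unfolding xy(1) frame_diff frame_minus_center inner_vec2 ..
  also have "f * y * cnj (f * (Q - P)) = of_real ((cmod f)^2) * (y * cnj (Q - P))"
    unfolding complex_norm_square by (simp add: algebra_simps)
  finally have "Re (y * cnj (Q - P)) = 0" using T(3) f by simp
  hence "Re ((Q - P) * cnj y) = 0" by (simp add: algebra_simps)
  moreover have "P * cnj y = y * cnj y - of_real x * ((Q - P) * cnj y)" 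
    "Q * cnj y = y * cnj y + of_real (1 - x) * ((Q - P) * cnj y)" by (simp_all add: xy(2) algebra_simps)
  moreover have "Re (y * cnj y) = \<tau>^2" unfolding complex_norm_square[symmetric] y by simp
  ultimately have "Re (P * cnj y) = \<tau>^2" "Re (Q * cnj y) = \<tau>^2" by (simp_all only: minus_complex.simps plus_complex.simps Re_real_mult)
  moreover have "Re (z * cnj (y / of_real \<tau>)) = Re (z * cnj y) / \<tau>" for z by (simp add: Re_divide_of_real)
  ultimately show ?thesis using that[of "y / of_real \<tau>"] y \<tau> by (simp add: norm_divide power2_eq_square)
qed

text \<open>In the coordinate \<open>z\<close> of the point \<open>frame C f z\<close> the common incircle is the unit circle and
  Feuerbach's point is \<open>1\<close>.\<close>

locale ellipse_frame =
  fixes a b m :: real and C :: "real^2" and f k :: complex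
  assumes f: "f \<noteq> 0" and k0: "k \<noteq> 0" and k: "cmod k < 1 / 2" and m: "m > 0"
    and ell: "\<And>z. (frame C f z $ 1)^2 / a^2 + (frame C f z $ 2)^2 / b^2 - 1 = m * ellipse_form k z"
begin

definition \<Phi> where "\<Phi> = frame C f"

text \<open>The common value of u + v + w and uv + vw + wu for contact points with product
  \<open>l\<close>.\<close>

definition \<sigma> where "\<sigma> l = k * l + cnj k"

lemma mem_ellipse:
  "\<Phi> z \<in> std_ellipse a b \<longleftrightarrow> ellipse_form k z = 0"
  "\<Phi> z \<in> std_ellipse_interior a b \<longleftrightarrow> ellipse_form k z < 0"
  "\<Phi> z \<in> std_ellipse_region a b \<longleftrightarrow> ellipse_form k z \<le> 0"
proof -
  have *: "(frame C f z $ 1)^2 / a^2 + (frame C f z $ 2)^2 / b^2 = 1 + m * ellipse_form k z"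
    using ell[of z] by simp
  show "\<Phi> z \<in> std_ellipse a b \<longleftrightarrow> ellipse_form k z = 0"
    "\<Phi> z \<in> std_ellipse_interior a b \<longleftrightarrow> ellipse_form k z < 0"
    "\<Phi> z \<in> std_ellipse_region a b \<longleftrightarrow> ellipse_form k z \<le> 0"
    using m unfolding \<Phi>_def std_ellipse_def std_ellipse_interior_def std_ellipse_region_def mem_Collect_eq *
    by (auto simp: mult_less_0_iff mult_le_0_iff)
qed

text \<open>The terms with \<open>k\<close> contribute at most 6 |k| < 3 on the unit circle, whereas
  |z|^2 - 4 = -3.\<close>

lemma form_circle_neg:
  assumes "cmod z = 1"
  shows "ellipse_form k z < 0"
proof -
  have "\<bar>Re (k * z^2)\<bar> \<le> cmod k" "\<bar>Re (k * z)\<bar> \<le> cmod k"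
    using abs_Re_le_cmod[of "k * z^2"] abs_Re_le_cmod[of "k * z"] assms
    by (simp_all add: norm_mult norm_power)
  thus ?thesis using assms k unfolding ellipse_form_def by (simp add: abs_le_iff)
qed

lemma circle_interior: "sphere C (cmod f) \<subseteq> std_ellipse_interior a b"
proof
  fix X assume X: "X \<in> sphere C (cmod f)"
  obtain z where z: "X = \<Phi> z" using frame_surj[OF f] unfolding \<Phi>_def by metis
  have "cmod z = 1" using X dist_frame[of C f 0 z] f by (simp add: z \<Phi>_def)
  thus "X \<in> std_ellipse_interior a b" unfolding z mem_ellipse by (rule form_circle_neg)
qed

lemma circle_interior_imp_less:
  assumes "sphere C (\<tau> * cmod f) \<subseteq> std_ellipse_interior a b" "\<tau> > 0"
  shows "\<tau> < 2"
proof -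
  have *: "ellipse_form k (of_real \<tau> * t) < 0" if "cmod t = 1" for t
  proof -
    have "\<Phi> (of_real \<tau> * t) \<in> sphere C (\<tau> * cmod f)"
      using dist_frame[of C f 0 "of_real \<tau> * t"] that assms(2) by (simp add: \<Phi>_def norm_mult)
    thus ?thesis using assms mem_ellipse by blast
  qed
  \<comment> \<open>Summing over the four directions 1, -1, i, -i cancels both terms with
    \<open>k\<close>.\<close>
  have "4 * \<tau>^2 - 16 = ellipse_form k (of_real \<tau> * 1) + ellipse_form k (of_real \<tau> * (-1)) +
     ellipse_form k (of_real \<tau> * \<i>) + ellipse_form k (of_real \<tau> * (-\<i>))"
    using assms(2) by (simp add: ellipse_form_def norm_mult power_mult_distrib)
  also have "\<dots> < 0" using *[of 1] *[of "-1"] *[of "\<i>"] *[of "-\<i>"] by simp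
  finally have "\<tau>^2 < 2^2" by simp
  thus ?thesis using assms(2) by (metis power2_less_imp_less zero_le_numeral)
qed

text \<open>Along the line through two points of the ellipse the form is B(t^2 - t) with B > 0. It
  is negative at the contact point, since the circle is inside the ellipse, so the contact point
  lies strictly between the vertices.\<close>

lemma tangent_side:
  assumes w: "cmod w = 1" and P: "Re (P * cnj w) = 1" and Q: "Re (Q * cnj w) = 1" and ne: "P \<noteq> Q"
    and E: "ellipse_form k P = 0" "ellipse_form k Q = 0"
  shows "side_tangent (\<Phi> P) (\<Phi> Q) (sphere C (cmod f))"
proof -
  have ne': "\<Phi> P \<noteq> \<Phi> Q" using ne frame_eq_iff[OF f] by (simp add: \<Phi>_def)
  obtain t where t: "w = P + of_real t * (Q - P)" using real_ratio_on_tangent[OF w P Q ne] .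
  define A where "A = Re ((2 * cnj P - 4 * k * P + 4 * k) * (Q - P))"
  define B where "B = (cmod (Q - P))^2 - 2 * Re (k * (Q - P)^2)"
  have B: "B > 0" unfolding B_def by (rule dominated_quadratic_pos[OF k]) (use ne in simp)
  have "A + B = 0" using ellipse_form_line[of k P 1 "Q - P"] E by (simp add: A_def B_def)
  hence "A = - B" by simp
  moreover have "t * A + t^2 * B < 0" using form_circle_neg[OF w] ellipse_form_line[of k P t "Q - P"] E
    by (simp add: A_def B_def t)
  ultimately have "B * (t^2 - t) < 0" by (simp add: algebra_simps)
  hence "t * (t - 1) < 0" using B by (simp add: mult_less_0_iff algebra_simps power2_eq_square)
  hence t01: "0 < t" "t < 1" by (auto simp: mult_less_0_iff)
  have w': "\<Phi> w = \<Phi> P + t *\<^sub>R (\<Phi> Q - \<Phi> P)" unfolding \<Phi>_def t by (rule frame_affine)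
  have seg: "\<Phi> w \<in> closed_segment (\<Phi> P) (\<Phi> Q)" unfolding closed_segment_def w' using t01
    by (auto intro!: exI[of _ t] simp: algebra_simps)
  have "dist C (\<Phi> w) = cmod f" using dist_frame[of C f 0 w] w by (simp add: \<Phi>_def)
  moreover have "(\<Phi> w - C) \<bullet> (\<Phi> Q - \<Phi> P) = 0"
  proof -
    have "(\<Phi> w - C) \<bullet> (\<Phi> Q - \<Phi> P) = Re (f * w * cnj (f * (Q - P)))"
      unfolding \<Phi>_def frame_diff frame_minus_center inner_vec2 ..
    also have "f * w * cnj (f * (Q - P)) = of_real ((cmod f)^2) * cnj ((Q - P) * cnj w)"
      unfolding complex_norm_square by (simp add: algebra_simps)
    also have "Re \<dots> = (cmod f)^2 * (Re (Q * cnj w) - Re (P * cnj w))"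
      by (simp add: algebra_simps)
    finally show ?thesis using P Q by simp
  qed
  moreover have "\<Phi> w \<in> affine hull {\<Phi> P, \<Phi> Q}" unfolding \<Phi>_def affine_hull_frame t by blast
  ultimately show ?thesis unfolding side_tangent_def tangent_line_sphere_iff[OF ne'] using seg by blast
qed

definition touching :: "complex \<Rightarrow> complex \<Rightarrow> complex \<Rightarrow> bool" where
  "touching u v w \<longleftrightarrow> cmod u = 1 \<and> cmod v = 1 \<and> cmod w = 1 \<and> u + v + w = \<sigma> (u * v * w)"

lemma norm_\<sigma>: "cmod l = 1 \<Longrightarrow> cmod (\<sigma> l) < 1"
  using norm_triangle_ineq[of "k * l" "cnj k"] k by (simp add: \<sigma>_def norm_mult)

lemma \<sigma>_reflect: "cmod l = 1 \<Longrightarrow> l * cnj (\<sigma> l) = \<sigma> l"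
  using unit_cnj[of l] by (auto simp: \<sigma>_def field_simps)

text \<open>This identifies the single parameter of the equilateral triangle, whose contact points
  have sum zero.\<close>

lemma \<sigma>_eq_0_iff: "\<sigma> l = 0 \<longleftrightarrow> l = - cnj k / k"
  using k0 by (auto simp: \<sigma>_def field_simps eq_neg_iff_add_eq_0)

lemma touchingD:
  assumes "touching u v w"
  shows "cmod u = 1" "cmod v = 1" "cmod w = 1" "u + v + w = \<sigma> (u * v * w)"
    "u * v + v * w + w * u = \<sigma> (u * v * w)" "cmod (u * v * w) = 1" "cmod (\<sigma> (u * v * w)) < 1"
    "u \<noteq> v" "v \<noteq> w" "w \<noteq> u" "v + w \<noteq> 0" "w + u \<noteq> 0" "u + v \<noteq> 0"
proof -
  show un: "cmod u = 1" "cmod v = 1" "cmod w = 1" and s: "u + v + w = \<sigma> (u * v * w)"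
    using assms by (auto simp: touching_def)
  show l: "cmod (u * v * w) = 1" using un by (simp add: norm_mult)
  show s1: "cmod (\<sigma> (u * v * w)) < 1" by (rule norm_\<sigma>[OF l])
  show "u * v + v * w + w * u = \<sigma> (u * v * w)"
    unfolding cnj_sum_unit[OF un] s by (rule \<sigma>_reflect[OF l])
  have "cmod (u + v + w) < 1" "cmod (v + w + u) < 1" "cmod (w + u + v) < 1"
    using s1 unfolding s[symmetric] by (simp_all add: algebra_simps)
  thus "u \<noteq> v" "v \<noteq> w" "w \<noteq> u" "v + w \<noteq> 0" "w + u \<noteq> 0" "u + v \<noteq> 0"
    using touch_points_distinct[of u v w] touch_points_distinct[of v w u] touch_points_distinct[of w u v] un by auto
qed

lemma touching_rotate: "touching u v w \<Longrightarrow> touching v w u"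
  by (simp add: touching_def algebra_simps)

lemma family_imp_touching:
  assumes "(X, Y, Z) \<in> poncelet_family a b C"
  obtains u v w where "touching u v w" "X = \<Phi> (2 * v * w / (v + w))" "Y = \<Phi> (2 * w * u / (w + u))"
    "Z = \<Phi> (2 * u * v / (u + v))"
proof -
  obtain r where nc: "\<not> collinear {X, Y, Z}" and on: "{X, Y, Z} \<subseteq> std_ellipse a b"
    and inc: "is_incircle X Y Z C r" and sub: "sphere C r \<subseteq> std_ellipse_interior a b"
    using assms unfolding poncelet_family_def by auto
  \<comment> \<open>The radius is arbitrary at first; its ratio to \<open>cmod f\<close> is shown to
    be 1 by the closure condition and nestedness.\<close>
  define \<tau> where "\<tau> = r / cmod f"
  have \<tau>: "\<tau> > 0" "r = \<tau> * cmod f" using inc f by (auto simp: \<tau>_def is_incircle_def)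
  obtain P Q R where PQR: "X = \<Phi> P" "Y = \<Phi> Q" "Z = \<Phi> R" using frame_surj[OF f] unfolding \<Phi>_def by metis
  obtain w where w: "cmod w = 1" "Re (P * cnj w) = \<tau>" "Re (Q * cnj w) = \<tau>"
    using side_tangent_frame[OF f \<tau>(1), of C P Q] inc unfolding is_incircle_def PQR \<Phi>_def \<tau>(2) by metis
  obtain u where u: "cmod u = 1" "Re (Q * cnj u) = \<tau>" "Re (R * cnj u) = \<tau>"
    using side_tangent_frame[OF f \<tau>(1), of C Q R] inc unfolding is_incircle_def PQR \<Phi>_def \<tau>(2) by metis
  obtain v where v: "cmod v = 1" "Re (R * cnj v) = \<tau>" "Re (P * cnj v) = \<tau>"
    using side_tangent_frame[OF f \<tau>(1), of C R P] inc unfolding is_incircle_def PQR \<Phi>_def \<tau>(2) by metis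
  \<comment> \<open>A tangent through all three vertices would make them collinear: multiplied by
    cnj t, both Q - P and R - P are purely imaginary, so their quotient is real. Hence the three
    contact points are distinct.\<close>
  have ds: "False" if t: "Re (P * cnj t) = \<tau>" "Re (Q * cnj t) = \<tau>" "Re (R * cnj t) = \<tau>" "cmod t = 1" for t
  proof -
    have "P \<noteq> Q" using nc unfolding PQR by (auto simp: collinear_2)
    define y where "y = (R - P) / (Q - P)"
    have e: "Re ((Q - P) * cnj t) = 0" "Re ((R - P) * cnj t) = 0" using t by (simp_all add: left_diff_distrib)
    have ct: "cnj t \<noteq> 0" using t by auto
    have QP: "(Q - P) * cnj t = \<i> * of_real (Im ((Q - P) * cnj t))" and RP: "(R - P) * cnj t = \<i> * of_real (Im ((R - P) * cnj t))"
      using e by (simp_all only: complex_eq_iff) (simp_all)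
    have "y = ((R - P) * cnj t) / ((Q - P) * cnj t)" using ct by (simp add: y_def)
    also have "\<dots> = of_real (Im ((R - P) * cnj t) / Im ((Q - P) * cnj t))"
      by (subst QP, subst RP) simp
    finally obtain x where x: "y = of_real x" by blast
    have "R = P + of_real x * (Q - P)" using \<open>P \<noteq> Q\<close> unfolding x[symmetric] y_def by simp
    hence "Z \<in> affine hull {X, Y}" unfolding PQR \<Phi>_def affine_hull_frame by blast
    moreover have "X \<noteq> Y" using nc by (auto simp: collinear_2)
    ultimately show False using nc collinear_3_affine_hull by blast
  qed
  have uvw: "u \<noteq> v" "v \<noteq> w" "w \<noteq> u" using ds u v w by auto
  have div: "Re (z / of_real \<tau> * cnj t) = 1" if "Re (z * cnj t) = \<tau>" for z t
  proof -
    have "z / of_real \<tau> * cnj t = (z * cnj t) / of_real \<tau>" by simp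
    thus ?thesis using that \<tau>(1) by (simp only: Re_divide_of_real) simp
  qed
  have 1: "v + w \<noteq> 0" "P / of_real \<tau> = 2 * v * w / (v + w)"
    using tangents_meet[OF v(1) w(1) uvw(2) div[OF v(3)] div[OF w(2)]] by auto
  have 2: "w + u \<noteq> 0" "Q / of_real \<tau> = 2 * w * u / (w + u)"
    using tangents_meet[OF w(1) u(1) uvw(3) div[OF w(3)] div[OF u(2)]] by auto
  have 3: "u + v \<noteq> 0" "R / of_real \<tau> = 2 * u * v / (u + v)"
    using tangents_meet[OF u(1) v(1) uvw(1) div[OF u(3)] div[OF v(2)]] by auto
  have P: "P = of_real \<tau> * (2 * v * w / (v + w))" and Q: "Q = of_real \<tau> * (2 * w * u / (w + u))"
    and R: "R = of_real \<tau> * (2 * u * v / (u + v))"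
    unfolding 1(2)[symmetric] 2(2)[symmetric] 3(2)[symmetric] using \<tau>(1) by simp_all
  have E: "ellipse_form k P = 0" "ellipse_form k Q = 0" "ellipse_form k R = 0"
    using on unfolding PQR by (simp_all add: mem_ellipse)
  note pc = poncelet_condition[OF u(1) v(1) w(1) uvw 1(1) 2(1) 3(1) E[unfolded P Q R]]
  \<comment> \<open>The other root \<open>\<tau> = 1 / cmod k\<close> exceeds 2 and belongs to a circle that is not nested.\<close>
  have "\<tau> < 2" using circle_interior_imp_less sub \<tau> by blast
  hence "cmod k * \<tau> < (1/2) * 2" using k \<tau>(1) by (intro mult_strict_mono) auto
  hence "(cmod k * \<tau>)^2 < 1" using \<tau>(1) by (simp add: abs_square_less_1)
  hence "1 - \<tau>^2 = 0" using pc(2) by (auto simp: power_mult_distrib)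
  hence \<tau>1: "\<tau> = 1" using \<tau>(1) by (simp add: power2_eq_1_iff)
  have "touching u v w" using pc(1) u v w unfolding touching_def \<sigma>_def \<tau>1 by simp
  thus ?thesis using that P Q R unfolding PQR \<tau>1 by simp
qed

lemma touching_imp_family:
  fixes u v w
  defines "P \<equiv> 2 * v * w / (v + w)" and "Q \<equiv> 2 * w * u / (w + u)" and "R \<equiv> 2 * u * v / (u + v)"
  assumes t: "touching u v w"
  shows "(\<Phi> P, \<Phi> Q, \<Phi> R) \<in> poncelet_family a b C" "is_incircle (\<Phi> P) (\<Phi> Q) (\<Phi> R) C (cmod f)"
    "\<not> collinear {\<Phi> P, \<Phi> Q, \<Phi> R}"
proof -
  note d = touchingD[OF t]
  have E: "ellipse_form k (2 * y * z / (y + z)) = 0" if "touching x y z" for x y z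
    using vertex_on_ellipse[of x y z k] touchingD[OF that] unfolding \<sigma>_def by simp
  have Es: "ellipse_form k P = 0" "ellipse_form k Q = 0" "ellipse_form k R = 0"
    using E t touching_rotate unfolding P_def Q_def R_def by blast+
  have tan: "Re (P * cnj v) = 1" "Re (P * cnj w) = 1" "Re (Q * cnj w) = 1" "Re (Q * cnj u) = 1"
    "Re (R * cnj u) = 1" "Re (R * cnj v) = 1"
    unfolding P_def Q_def R_def
    using d vertex_on_tangents[of v w] vertex_on_tangents[of w u] vertex_on_tangents[of u v] by blast+
  have ne: "2 * x * y / (x + y) \<noteq> 2 * y * z / (y + z)"
    if n: "x + y \<noteq> 0" "y + z \<noteq> 0" "z \<noteq> x" "y \<noteq> 0" for x y z :: complex
  proof
    assume "2 * x * y / (x + y) = 2 * y * z / (y + z)"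
    hence "2 * x * y * (y + z) = 2 * y * z * (x + y)" using n by (simp add: frac_eq_eq)
    hence "2 * y^2 * (x - z) = 0" by algebra
    thus False using n by simp
  qed
  have nz: "u \<noteq> 0" "v \<noteq> 0" "w \<noteq> 0" using d by auto
  have PQ: "P \<noteq> Q" and QR: "Q \<noteq> R" and RP: "R \<noteq> P"
    unfolding P_def Q_def R_def using ne[of v w u] ne[of w u v] ne[of u v w] d nz by auto
  show inc: "is_incircle (\<Phi> P) (\<Phi> Q) (\<Phi> R) C (cmod f)"
    unfolding is_incircle_def using f tangent_side d tan PQ QR RP Es by auto
  show nc: "\<not> collinear {\<Phi> P, \<Phi> Q, \<Phi> R}"
  proof
    assume "collinear {\<Phi> P, \<Phi> Q, \<Phi> R}"
    moreover have "\<Phi> P \<noteq> \<Phi> Q" using PQ frame_eq_iff[OF f] by (simp add: \<Phi>_def)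
    ultimately have "\<Phi> R \<in> affine hull {\<Phi> P, \<Phi> Q}" using collinear_3_affine_hull by blast
    then obtain x where "R = P + of_real x * (Q - P)"
      unfolding \<Phi>_def affine_hull_frame using frame_eq_iff[OF f] by auto
    \<comment> \<open>A collinear \<open>R\<close> would lie on the tangent at w as well as on the
      one at u, and these two meet in \<open>Q\<close>.\<close>
    hence "R * cnj w = P * cnj w + of_real x * (Q * cnj w - P * cnj w)" by algebra
    hence "Re (R * cnj w) = Re (P * cnj w) + x * (Re (Q * cnj w) - Re (P * cnj w))"
      by (simp only: plus_complex.simps minus_complex.simps Re_real_mult)
    hence "Re (R * cnj w) = 1" using tan by simp
    hence "R = Q" using tangents_meet[of w u R] tan d unfolding Q_def by auto
    thus False using QR by simp
  qed
  show "(\<Phi> P, \<Phi> Q, \<Phi> R) \<in> poncelet_family a b C"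
    unfolding poncelet_family_def using nc inc circle_interior Es by (auto simp: mem_ellipse)
qed

end

section \<open>Feuerbach's point, its isogonal conjugate and the locus over the family\<close>

lemma barycentric_exist:
  fixes X :: "real^2"
  assumes "\<not> collinear {P, Q, R}"
  obtains x y z where "x + y + z = 1" "X = x *\<^sub>R P + y *\<^sub>R Q + z *\<^sub>R R"
proof -
  define d where "d = (Q$1 - P$1) * (R$2 - P$2) - (Q$2 - P$2) * (R$1 - P$1)"
  have d: "d \<noteq> 0" using det_zero_imp_collinear[of Q P R] assms by (auto simp: d_def)
  define y z where "y = ((X$1 - P$1) * (R$2 - P$2) - (X$2 - P$2) * (R$1 - P$1)) / d"
    and "z = ((Q$1 - P$1) * (X$2 - P$2) - (Q$2 - P$2) * (X$1 - P$1)) / d"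
  have yz: "y * d = (X$1 - P$1) * (R$2 - P$2) - (X$2 - P$2) * (R$1 - P$1)"
    "z * d = (Q$1 - P$1) * (X$2 - P$2) - (Q$2 - P$2) * (X$1 - P$1)" using d by (auto simp: y_def z_def)
  have "d * (X$1 - ((1 - y - z) * P$1 + y * Q$1 + z * R$1)) = 0"
    using yz unfolding d_def by algebra
  moreover have "d * (X$2 - ((1 - y - z) * P$2 + y * Q$2 + z * R$2)) = 0"
    using yz unfolding d_def by algebra
  ultimately have "X = (1 - y - z) *\<^sub>R P + y *\<^sub>R Q + z *\<^sub>R R"
    using d by (simp add: vec_eq_iff forall_2)
  thus ?thesis using that[of "1 - y - z" y z] by simp
qed

lemma midpoint_frame: "midpoint (frame C f z) (frame C f w) = frame C f ((z + w) / 2)"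
proof -
  have "f * ((z + w) / 2) = of_real (1/2) * (f * z) + of_real (1/2) * (f * w)" by (simp add: algebra_simps add_divide_distrib)
  thus ?thesis unfolding frame_def midpoint_def by (simp add: vec_eq_iff forall_2 field_simps)
qed

context ellipse_frame
begin

text \<open>By uniqueness the two circles are the unit circle and the one with centre
  \<open>N\<close> and radius 1 - N, in frame coordinates. They coincide for s = 0, where N = 0;
  otherwise N < 0 and they touch only at 1.\<close>

lemma is_X11_iff:
  fixes u v w
  defines "P \<equiv> 2 * v * w / (v + w)" and "Q \<equiv> 2 * w * u / (w + u)" and "R \<equiv> 2 * u * v / (u + v)"
  assumes t: "touching u v w"
  shows "is_X11 (\<Phi> P) (\<Phi> Q) (\<Phi> R) F \<longleftrightarrow> \<sigma> (u * v * w) \<noteq> 0 \<and> F = \<Phi> 1"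
proof -
  define s where "s = \<sigma> (u * v * w)"
  define N where "N = - ((cmod s)^2 / (1 - (cmod s)^2))"
  note d = touchingD[OF t, folded s_def]
  note fam = touching_imp_family[OF t, folded P_def Q_def R_def]
  have s2: "(cmod s)^2 < 1" using d(7) by (simp add: abs_square_less_1)
  have N0: "N \<le> 0" "N = 0 \<longleftrightarrow> s = 0" using s2 by (auto simp: N_def)
  have np: "is_nine_point_circle (\<Phi> P) (\<Phi> Q) (\<Phi> R) (\<Phi> (of_real N)) ((1 - N) * cmod f)"
  proof -
    have M1: "cmod ((Q + R) / 2 - of_real N) = 1 - N"
      unfolding Q_def R_def by (rule nine_point_midpoint[OF d(1-3,11-13,4,5,7) N_def])
    have M2: "cmod ((R + P) / 2 - of_real N) = 1 - N"
      unfolding P_def R_def by (rule nine_point_midpoint[of v w u s])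
        (use d N_def in \<open>simp_all add: algebra_simps\<close>)
    have M3: "cmod ((P + Q) / 2 - of_real N) = 1 - N"
      unfolding P_def Q_def by (rule nine_point_midpoint[of w u v s])
        (use d N_def in \<open>simp_all add: algebra_simps\<close>)
    show ?thesis unfolding is_nine_point_circle_def \<Phi>_def midpoint_frame
      using M1 M2 M3 N0 f by (simp add: dist_frame norm_minus_commute mult.commute)
  qed
  have circ: "\<Phi> z \<in> sphere C (cmod f) \<inter> sphere (\<Phi> (of_real N)) ((1 - N) * cmod f) \<longleftrightarrow>
      cmod z = 1 \<and> cmod (z - of_real N) = 1 - N" for z
    using dist_frame[of C f 0 z] dist_frame[of C f "of_real N" z] f
    by (simp add: \<Phi>_def norm_minus_commute)
  have "is_X11 (\<Phi> P) (\<Phi> Q) (\<Phi> R) F \<longleftrightarrow> sphere C (cmod f) \<inter> sphere (\<Phi> (of_real N)) ((1 - N) * cmod f) = {F}"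
  proof
    assume "is_X11 (\<Phi> P) (\<Phi> Q) (\<Phi> R) F"
    then obtain C' r N' s' where "is_incircle (\<Phi> P) (\<Phi> Q) (\<Phi> R) C' r" "is_nine_point_circle (\<Phi> P) (\<Phi> Q) (\<Phi> R) N' s'"
      "sphere C' r \<inter> sphere N' s' = {F}" unfolding is_X11_def by blast
    thus "sphere C (cmod f) \<inter> sphere (\<Phi> (of_real N)) ((1 - N) * cmod f) = {F}"
      using incircle_unique[OF fam(3,2)] nine_point_circle_unique[OF fam(3) np] by metis
  qed (use fam(2) np in \<open>unfold is_X11_def, blast\<close>)
  also have "\<dots> \<longleftrightarrow> s \<noteq> 0 \<and> F = \<Phi> 1"
  proof (cases "s = 0")
    case True
    hence "N = 0" using N0 by simp
    hence "\<Phi> 1 \<in> sphere C (cmod f) \<inter> sphere (\<Phi> (of_real N)) ((1 - N) * cmod f)"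
      "\<Phi> (-1) \<in> sphere C (cmod f) \<inter> sphere (\<Phi> (of_real N)) ((1 - N) * cmod f)" unfolding circ by auto
    moreover have "\<Phi> 1 \<noteq> \<Phi> (-1)" unfolding \<Phi>_def frame_eq_iff[OF f] by simp
    ultimately show ?thesis using True by (metis singletonD)
  next
    case False
    hence "N < 0" using N0 by linarith
    note circ' = circ[unfolded internally_tangent_circles[OF this]]
    have "sphere C (cmod f) \<inter> sphere (\<Phi> (of_real N)) ((1 - N) * cmod f) = {\<Phi> 1}"
    proof (intro equalityI subsetI)
      fix X assume "X \<in> sphere C (cmod f) \<inter> sphere (\<Phi> (of_real N)) ((1 - N) * cmod f)"
      moreover obtain z where "X = \<Phi> z" using frame_surj[OF f] unfolding \<Phi>_def by metis
      ultimately show "X \<in> {\<Phi> 1}" using circ' by simp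
    qed (use circ' in simp)
    thus ?thesis using False by auto
  qed
  finally show ?thesis by (simp add: s_def)
qed

text \<open>The frame multiplies all squared side lengths by |f|^2, a factor that cancels when the
  weights are normalized, so the computation in complex coordinates carries over.\<close>

lemma is_isogonal_conjugate_iff:
  fixes u v w
  defines "P \<equiv> 2 * v * w / (v + w)" and "Q \<equiv> 2 * w * u / (w + u)" and "R \<equiv> 2 * u * v / (u + v)"
  assumes t: "touching u v w"
  shows "is_isogonal_conjugate (\<Phi> P) (\<Phi> Q) (\<Phi> R) (\<Phi> 1) X \<longleftrightarrow> X = \<Phi> (conj_point k (u * v * w))"
proof -
  note d = touchingD[OF t]
  note fam = touching_imp_family[OF t, folded P_def Q_def R_def]
  have key: "w1 + w2 + w3 \<noteq> 0 \<and>
      (1 / (w1 + w2 + w3)) *\<^sub>R (w1 *\<^sub>R \<Phi> P + w2 *\<^sub>R \<Phi> Q + w3 *\<^sub>R \<Phi> R) = \<Phi> (conj_point k (u * v * w))"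
    if z: "z1 + z2 + z3 = 1" "\<Phi> 1 = z1 *\<^sub>R \<Phi> P + z2 *\<^sub>R \<Phi> Q + z3 *\<^sub>R \<Phi> R"
      and w: "w1 = (dist (\<Phi> Q) (\<Phi> R))^2 * z2 * z3" "w2 = (dist (\<Phi> R) (\<Phi> P))^2 * z3 * z1"
      "w3 = (dist (\<Phi> P) (\<Phi> Q))^2 * z1 * z2" for z1 z2 z3 w1 w2 w3 :: real
  proof -
    have zz: "of_real z1 * P + of_real z2 * Q + of_real z3 * R = 1"
      using z(2) unfolding \<Phi>_def frame_barycentric[OF z(1)] frame_eq_iff[OF f] by simp
    define y1 y2 y3 where "y1 = (cmod (Q - R))^2 * z2 * z3" and "y2 = (cmod (R - P))^2 * z3 * z1"
      and "y3 = (cmod (P - Q))^2 * z1 * z2"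
    have wy: "w1 = (cmod f)^2 * y1" "w2 = (cmod f)^2 * y2" "w3 = (cmod f)^2 * y3"
      unfolding w y1_def y2_def y3_def \<Phi>_def dist_frame by (simp_all add: power_mult_distrib)
    hence W: "w1 + w2 + w3 = (cmod f)^2 * (y1 + y2 + y3)" by (simp add: algebra_simps)
    note iso = isogonal_image[OF d(1-3,8-13,4,5) refl d(7) z(1) zz[unfolded P_def Q_def R_def],
      folded P_def Q_def R_def, folded y1_def y2_def y3_def]
    have W0: "w1 + w2 + w3 \<noteq> 0" unfolding W using iso(1) f by simp
    define x1 x2 x3 where "x1 = w1 / (w1 + w2 + w3)" and "x2 = w2 / (w1 + w2 + w3)" and "x3 = w3 / (w1 + w2 + w3)"
    have x: "x1 + x2 + x3 = 1" using W0 by (simp add: x1_def x2_def x3_def add_divide_distrib[symmetric])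
    have xy: "x1 = y1 / (y1 + y2 + y3)" "x2 = y2 / (y1 + y2 + y3)" "x3 = y3 / (y1 + y2 + y3)"
      unfolding x1_def x2_def x3_def W unfolding wy using f by simp_all
    have "(1 / (w1 + w2 + w3)) *\<^sub>R (w1 *\<^sub>R \<Phi> P + w2 *\<^sub>R \<Phi> Q + w3 *\<^sub>R \<Phi> R) = x1 *\<^sub>R \<Phi> P + x2 *\<^sub>R \<Phi> Q + x3 *\<^sub>R \<Phi> R"
      by (simp add: scaleR_add_right x1_def x2_def x3_def)
    also have "\<dots> = \<Phi> (of_real x1 * P + of_real x2 * Q + of_real x3 * R)"
      unfolding \<Phi>_def by (rule frame_barycentric[OF x])
    also have "of_real x1 * P + of_real x2 * Q + of_real x3 * R = (of_real y1 * P + of_real y2 * Q + of_real y3 * R) / of_real (y1 + y2 + y3)"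
      unfolding xy by (simp add: add_divide_distrib)
    also have "\<dots> = conj_point k (u * v * w)"
      unfolding iso(2) conj_point_def \<sigma>_def[symmetric] using iso(1)
      by (subst nonzero_mult_div_cancel_left) (simp_all only: of_real_eq_0_iff not_False_eq_True)
    finally show ?thesis using W0 by blast
  qed
  obtain z1 z2 z3 where z: "z1 + z2 + z3 = 1" "\<Phi> 1 = z1 *\<^sub>R \<Phi> P + z2 *\<^sub>R \<Phi> Q + z3 *\<^sub>R \<Phi> R"
    using barycentric_exist[OF fam(3)] .
  show ?thesis
  proof
    assume "is_isogonal_conjugate (\<Phi> P) (\<Phi> Q) (\<Phi> R) (\<Phi> 1) X"
    thus "X = \<Phi> (conj_point k (u * v * w))" unfolding is_isogonal_conjugate_def using key by metis
  next
    assume "X = \<Phi> (conj_point k (u * v * w))"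
    thus "is_isogonal_conjugate (\<Phi> P) (\<Phi> Q) (\<Phi> R) (\<Phi> 1) X"
      unfolding is_isogonal_conjugate_def using key[OF z refl refl refl] z by metis
  qed
qed

text \<open>X59 depends on the triangle only through the product l of its contact points, and
  \<open>touch_points_exist\<close> realizes every l on the unit circle. The restriction on
  \<open>\<sigma> l\<close> removes the equilateral triangle.\<close>

lemma locus_X59:
  "locus is_X59 (poncelet_family a b C) = {\<Phi> (conj_point k l) | l. cmod l = 1 \<and> \<sigma> l \<noteq> 0}"
proof (intro equalityI subsetI)
  fix X assume "X \<in> locus is_X59 (poncelet_family a b C)"
  then obtain P Q R F where PQR: "(P, Q, R) \<in> poncelet_family a b C"
    and F: "is_X11 P Q R F" "is_isogonal_conjugate P Q R F X"
    unfolding locus_def is_X59_def by blast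
  obtain u v w where t: "touching u v w" and e: "P = \<Phi> (2 * v * w / (v + w))" "Q = \<Phi> (2 * w * u / (w + u))"
    "R = \<Phi> (2 * u * v / (u + v))" using family_imp_touching[OF PQR] .
  have "\<sigma> (u * v * w) \<noteq> 0" "X = \<Phi> (conj_point k (u * v * w))"
    using F unfolding e is_X11_iff[OF t] by (auto simp: is_isogonal_conjugate_iff[OF t])
  thus "X \<in> {\<Phi> (conj_point k l) | l. cmod l = 1 \<and> \<sigma> l \<noteq> 0}" using touchingD(6)[OF t] by blast
next
  fix X assume "X \<in> {\<Phi> (conj_point k l) | l. cmod l = 1 \<and> \<sigma> l \<noteq> 0}"
  then obtain l where l: "cmod l = 1" "\<sigma> l \<noteq> 0" "X = \<Phi> (conj_point k l)" by blast
  obtain u v w where uvw: "cmod u = 1" "cmod v = 1" "cmod w = 1" "u + v + w = \<sigma> l"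
    "u * v + v * w + w * u = \<sigma> l" "u * v * w = l"
    using touch_points_exist[OF l(1) norm_\<sigma>[OF l(1)] \<sigma>_reflect[OF l(1)]] .
  have t: "touching u v w" using uvw by (simp add: touching_def)
  have "is_X59 (\<Phi> (2 * v * w / (v + w))) (\<Phi> (2 * w * u / (w + u))) (\<Phi> (2 * u * v / (u + v))) X"
    unfolding is_X59_def is_X11_iff[OF t] using is_isogonal_conjugate_iff[OF t] l uvw(6) by auto
  thus "X \<in> locus is_X59 (poncelet_family a b C)"
    unfolding locus_def using touching_imp_family(1)[OF t] by blast
qed

section \<open>The locus completed at the equilateral parameter: ellipse and contact\<close>

definition L where "L = \<Phi> ` conj_point k ` {l. cmod l = 1}"

text \<open>For |l| = 1 the square |kl + cnj k|^2 equals 2 |k|^2 + 2 Re (k^2 l), so the denominator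
  is affine in l. The other claims are the nondegeneracy conditions needed for
  \<open>projective_circle_is_ellipse\<close>.\<close>

lemma conj_point_projective:
  defines "d0 \<equiv> 3 - 4 * Re k + 2 * (cmod k)^2" and "e \<equiv> k^2 - 2 * k"
    and "N \<equiv> - 2 * (2 - cnj k)" and "M \<equiv> - 2 * (1 - k)"
  shows "M \<noteq> 0" "2 * cmod e < \<bar>d0\<bar>" "d0 - 2 * Re (e * N / M) \<noteq> 0"
    "cmod l = 1 \<Longrightarrow> conj_point k l = (N + M * l) / of_real (d0 + 2 * Re (e * l))"
proof -
  have k1: "k \<noteq> 1" using k by auto
  thus M0: "M \<noteq> 0" by (simp add: M_def)
  \<comment> \<open>In terms of 1 - k the coefficients simplify: d0 = 1 + 2 |1 - k|^2 and e = (1 -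
    k)^2 - 1.\<close>
  define x y where "x = 1 - Re k" and "y = Im k"
  have kxy: "k = Complex (1 - x) y" by (simp add: x_def y_def)
  have x: "x > 1 / 2" using k abs_Re_le_cmod[of k] by (simp add: x_def)
  have "(cmod k)^2 < (1 / 2)^2" using k by (intro power_strict_mono) auto
  hence n: "(1 - x)^2 + y^2 < 1 / 4" unfolding cmod_power2 kxy by (simp add: power2_eq_square)
  have d0: "d0 = 1 + 2 * (x^2 + y^2)" unfolding d0_def cmod_power2 kxy by (simp add: algebra_simps power2_eq_square)
  have "(2 * cmod e)^2 = 4 * ((x^2 - y^2 - 1)^2 + (2 * x * y)^2)"
    unfolding power_mult_distrib cmod_power2 e_def kxy by (simp add: algebra_simps power2_eq_square)
  \<comment> \<open>The first subtracted term is positive because (1 - x)^2 + y^2 = |k|^2 < 1/4, the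
    second because x > 1/2.\<close>
  also have "\<dots> = d0^2 - 4 * (1 / 4 - ((1 - x)^2 + y^2)) - 8 * x * (2 * x - 1)"
    unfolding d0 by algebra
  also have "\<dots> < d0^2"
  proof -
    have *: "p - q - r < p" if "0 < q" "0 < r" for p q r :: real using that by simp
    show ?thesis by (rule *) (use x n in simp_all)
  qed
  finally show "2 * cmod e < \<bar>d0\<bar>" by (intro power2_less_imp_less[of "2 * cmod e"]) simp_all
  have "Re (e * N / M) * (cmod (1 - k))^2 = Re (e * (2 - cnj k) * cnj (1 - k))"
  proof -
    have "e * N / M = e * (2 - cnj k) / (1 - k)" unfolding N_def M_def mult.left_commute[of e]
      by (rule mult_divide_mult_cancel_left) simp
    also have "\<dots> = e * (2 - cnj k) * cnj (1 - k) / of_real ((cmod (1 - k))^2)"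
      unfolding complex_norm_square using k1 by simp
    finally show ?thesis using k1 by (simp only: Re_divide_of_real) simp
  qed
  also have "\<dots> * 2 = d0 * (cmod (1 - k))^2 - (1 + 2 * x) * (1 - ((1 - x)^2 + y^2))"
    unfolding e_def d0 cmod_power2 kxy by (simp add: algebra_simps power2_eq_square)
  finally have "(d0 - 2 * Re (e * N / M)) * (cmod (1 - k))^2 = (1 + 2 * x) * (1 - ((1 - x)^2 + y^2))"
    by (simp add: algebra_simps)
  moreover have "(1 + 2 * x) * (1 - ((1 - x)^2 + y^2)) > 0" using x n by simp
  ultimately show "d0 - 2 * Re (e * N / M) \<noteq> 0" by auto
  show "conj_point k l = (N + M * l) / of_real (d0 + 2 * Re (e * l))" if l: "cmod l = 1"
  proof -
    have "(cmod (k * l + cnj k))^2 = (cmod k)^2 * (cmod l)^2 + (cmod k)^2 + 2 * Re (k^2 * l)"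
      unfolding cmod_power2 by (simp add: algebra_simps power2_eq_square)
    hence eq: "conj_denom (k * l + cnj k) = d0 + 2 * Re (e * l)"
      using l unfolding conj_denom_def d0_def e_def by (simp add: algebra_simps)
    have "- 2 * (2 - (k * l + cnj k) + l) = N + M * l" unfolding N_def M_def by (simp add: algebra_simps)
    thus ?thesis unfolding conj_point_def eq by simp
  qed
qed

lemma L_is_ellipse: "is_ellipse L"
proof -
  have "conj_point k ` {l. cmod l = 1} = (\<lambda>l. (- 2 * (2 - cnj k) + - 2 * (1 - k) * l) /
    of_real (3 - 4 * Re k + 2 * (cmod k)^2 + 2 * Re ((k^2 - 2 * k) * l))) ` {l. cmod l = 1}"
    by (rule image_cong[OF refl]) (simp only: mem_Collect_eq conj_point_projective(4))
  thus ?thesis unfolding L_def \<Phi>_def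
    using projective_circle_is_ellipse[OF f conj_point_projective(1,2) refl conj_point_projective(3)] by simp
qed

lemma conj_point_inj: "inj_on (conj_point k) {l. cmod l = 1}"
  by (subst inj_on_cong[OF conj_point_projective(4)], simp)
    (rule projective_circle_inverse(3)[OF conj_point_projective(1,2) refl conj_point_projective(3)])

lemma form_conj_point:
  assumes "cmod l = 1"
  shows "ellipse_form k (conj_point k l) \<le> 0" "ellipse_form k (conj_point k l) = 0 \<longleftrightarrow> l = 1"
proof -
  have D: "conj_denom (k * l + cnj k) > 0" using conj_denom_pos[OF norm_\<sigma>[OF assms]] by (simp add: \<sigma>_def)
  have kl: "Re (k * l) < 1" using complex_Re_le_cmod[of "k * l"] k assms by (simp add: norm_mult)
  have l: "Re l \<le> 1" using complex_Re_le_cmod[of l] assms by simp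
  have "Re l = 1 \<longleftrightarrow> l = 1" using assms cmod_power2[of l] by (auto simp: complex_eq_iff)
  have "conj_denom (k * l + cnj k) \<noteq> 0" using D by simp
  note e = ellipse_form_conj_point[OF assms this]
  have "(1 - Re l) * (1 - Re (k * l)) \<ge> 0" using kl l by (intro mult_nonneg_nonneg) auto
  hence "ellipse_form k (conj_point k l) * (conj_denom (k * l + cnj k))^2 \<le> 0" unfolding e by linarith
  thus "ellipse_form k (conj_point k l) \<le> 0" using D by (simp add: mult_le_0_iff)
  have "ellipse_form k (conj_point k l) = 0 \<longleftrightarrow> (1 - Re l) * (1 - Re (k * l)) = 0" using e D by auto
  also have "\<dots> \<longleftrightarrow> l = 1" using kl \<open>Re l = 1 \<longleftrightarrow> l = 1\<close> by auto
  finally show "ellipse_form k (conj_point k l) = 0 \<longleftrightarrow> l = 1" .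
qed

text \<open>Along a direction \<open>d\<close> with Re (g d) = 0 the linear term of the form
  vanishes and the positive quadratic term remains. The line therefore meets the whole closed
  region, and not only the curve, in a single point.\<close>

lemma tangent_line_to_ellipse:
  assumes "ellipse_form k z = 0"
  obtains l A B where "A \<noteq> B" "l = affine hull {A, B}" "l \<inter> std_ellipse_region a b = {\<Phi> z}"
proof -
  define g where "g = 2 * cnj z - 4 * k * z + 4 * k"
  define d where "d = (if g = 0 then 1 else \<i> * cnj g)"
  have d: "d \<noteq> 0" by (simp add: d_def)
  have gd: "Re (g * d) = 0" by (simp add: d_def)
  have "ellipse_form k (z + of_real t * d) \<le> 0 \<longleftrightarrow> t = 0" for t
    using ellipse_form_line[of k z t d] dominated_quadratic_pos[OF k d] gd assms
    by (auto simp: g_def[symmetric] mult_le_0_iff not_le)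
  hence iff: "\<Phi> (z + of_real t * d) \<in> std_ellipse_region a b \<longleftrightarrow> t = 0" for t
    by (simp add: mem_ellipse)
  have "affine hull {\<Phi> z, \<Phi> (z + d)} = range (\<lambda>t. \<Phi> (z + of_real t * d))"
    unfolding \<Phi>_def affine_hull_frame by simp
  hence "affine hull {\<Phi> z, \<Phi> (z + d)} \<inter> std_ellipse_region a b = {\<Phi> z}"
    using iff iff[of 0] by (auto intro!: image_eqI[of _ _ 0])
  moreover have "\<Phi> z \<noteq> \<Phi> (z + d)" unfolding \<Phi>_def frame_eq_iff[OF f] using d by simp
  ultimately show ?thesis using that by blast
qed

text \<open>A line meeting the closed region only at the contact point is tangent there to every
  subset of the region through that point. So the tangent of the outer ellipse serves
  \<open>L\<close> as well.\<close>

lemma L_touches: "interior_touching_at L a b (\<Phi> (conj_point k 1))"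
proof -
  let ?T = "\<Phi> (conj_point k 1)"
  have sub: "L \<subseteq> std_ellipse_region a b"
    unfolding L_def using form_conj_point(1) by (auto simp: mem_ellipse)
  have int: "L \<inter> std_ellipse a b = {?T}"
    unfolding L_def using form_conj_point(2) by (auto simp: mem_ellipse)
  have bd: "std_ellipse a b \<subseteq> std_ellipse_region a b"
    by (auto simp: std_ellipse_def std_ellipse_region_def)
  have T: "ellipse_form k (conj_point k 1) = 0" using form_conj_point(2)[of 1] by simp
  obtain l A B where l: "A \<noteq> B" "l = affine hull {A, B}" "l \<inter> std_ellipse_region a b = {?T}"
    using tangent_line_to_ellipse[OF T] .
  have "tangent_line_at l S ?T" if "S \<subseteq> std_ellipse_region a b" "?T \<in> S" for S
    unfolding tangent_line_at_def using l that by blast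
  hence "tangent_curves_at L (std_ellipse a b) ?T"
    unfolding tangent_curves_at_def using sub bd int by blast
  thus ?thesis unfolding interior_touching_at_def using sub int by blast
qed

text \<open>Dropping the equilateral parameter removes exactly one point, because injectivity of
  \<open>conj_point k\<close> on the circle prevents any other parameter from reaching it.\<close>

lemma locus_eq_L_minus_point: "locus is_X59 (poncelet_family a b C) = L - {\<Phi> (conj_point k (- cnj k / k))}"
proof -
  have "cmod (- cnj k / k) = 1" using k0 by (simp add: norm_divide)
  hence "\<Phi> (conj_point k l) = \<Phi> (conj_point k (- cnj k / k)) \<longleftrightarrow> \<sigma> l = 0" if "cmod l = 1" for l
    using that inj_on_eq_iff[OF conj_point_inj] unfolding \<Phi>_def frame_eq_iff[OF f] \<sigma>_eq_0_iff by simp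
  thus ?thesis unfolding locus_X59 L_def by auto
qed

lemma missing_point_in_L: "\<Phi> (conj_point k (- cnj k / k)) \<in> L"
  unfolding L_def using k0 by (auto simp: norm_divide)

end

section \<open>Coordinates adapted to the given ellipse and incentre\<close>

theorem corollary8:
  fixes a b c :: real and C :: "real^2"
  assumes "a > b" and "b > 0" and "c^2 = a^2 - b^2"
    and "C \<in> std_ellipse (a * c^2 / (a^2 + 3 * b^2)) (b * c^2 / (3 * a^2 + b^2))"
  shows "\<exists>L p T. is_ellipse L \<and> p \<in> L \<and>
    locus is_X59 (poncelet_family a b C) = L - {p} \<and>
    interior_touching_at L a b T"
proof -
  define x y where "x = C $ 1" and "y = C $ 2"
  define g where "g = c^2"
  have g: "g = a^2 - b^2" using assms by (simp add: g_def)
  have a0: "a > 0" using assms by simp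
  have g0: "g > 0" using assms a0 by (simp add: g power_strict_mono)
  have on: "x^2 * (a^2 + 3 * b^2)^2 / (a^2 * g^2) + y^2 * (3 * a^2 + b^2)^2 / (b^2 * g^2) = 1"
    using assms(4) unfolding std_ellipse_def mem_Collect_eq x_def[symmetric] y_def[symmetric] g_def[symmetric]
    by (simp add: power_mult_distrib power_divide)
  \<comment> \<open>The vector from the centre to Feuerbach's point.\<close>
  define f where "f = Complex (2 * b^2 * x / g) (- (2 * a^2 * y / g))"
  have f: "f \<noteq> 0" using on g0 a0 assms(2) by (auto simp: f_def complex_eq_iff)
  define \<kappa> where "\<kappa> = g / (2 * (a^2 + b^2))"
  have ab: "a^2 + b^2 > 0" using a0 by (simp add: add_pos_nonneg)
  have \<kappa>: "0 < \<kappa>" "\<kappa> < 1 / 2" using g0 ab assms(2) by (simp_all add: \<kappa>_def g field_simps)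
  \<comment> \<open>The argument of f^2 undoes the rotation in the frame, so that Re (k z^2) is a
    multiple of X^2 - Y^2 in axis-parallel coordinates.\<close>
  define k where "k = of_real \<kappa> * f^2 / of_real ((cmod f)^2)"
  have nk: "cmod k = \<kappa>" using f \<kappa> by (simp add: k_def norm_mult norm_divide norm_power)
  \<comment> \<open>\<open>A\<close> is the mean of 1/a^2 and 1/b^2, and 2\<kappa> is the relative
    deviation of each of them from it.\<close>
  define A where "A = (a^2 + b^2) / (2 * a^2 * b^2)"
  define m where "m = A * (cmod f)^2"
  have A: "A > 0" using ab a0 assms(2) by (simp add: A_def)
  interpret ellipse_frame a b m C f k
  proof
    show "f \<noteq> 0" by (rule f)
    show "k \<noteq> 0" using nk \<kappa> by auto
    show "cmod k < 1 / 2" using nk \<kappa> by simp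
    show "m > 0" using A f by (simp add: m_def)
    show "(frame C f z $ 1)^2 / a^2 + (frame C f z $ 2)^2 / b^2 - 1 = m * ellipse_form k z" for z
    proof -
      define X Y where "X = Re (f * z)" and "Y = Im (f * z)"
      have k2: "k * z^2 = of_real (\<kappa> / (cmod f)^2) * (f * z)^2" "k * z = of_real (\<kappa> / (cmod f)^2) * (f * (f * z))"
        by (simp_all add: k_def power2_eq_square)
      have "Re (k * z^2) = \<kappa> / (cmod f)^2 * (X^2 - Y^2)"
        unfolding k2(1) Re_real_mult Re_power2 X_def Y_def ..
      hence 1: "(cmod f)^2 * Re (k * z^2) = \<kappa> * (X^2 - Y^2)" using f by simp
      have "Re (k * z) = \<kappa> / (cmod f)^2 * (Re f * X - Im f * Y)"
        unfolding k2(2) Re_real_mult X_def Y_def by simp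
      hence 2: "(cmod f)^2 * Re (k * z) = \<kappa> * (Re f * X - Im f * Y)" using f by simp
      have 3: "(cmod f)^2 * (cmod z)^2 = X^2 + Y^2"
        unfolding X_def Y_def cmod_power2[symmetric] by (simp add: norm_mult power_mult_distrib)
      have "m * ellipse_form k z = A * ((cmod f)^2 * (cmod z)^2 - 2 * ((cmod f)^2 * Re (k * z^2)) +
         4 * ((cmod f)^2 * Re (k * z)) - 4 * (cmod f)^2)"
        unfolding m_def ellipse_form_def by (simp add: algebra_simps)
      also have "\<dots> = A * (1 - 2 * \<kappa>) * X^2 + A * (1 + 2 * \<kappa>) * Y^2 + 4 * A * \<kappa> * (Re f * X - Im f * Y) - 4 * A * (cmod f)^2"
        unfolding 1 2 3 by (simp add: algebra_simps)
      also have "A * (1 - 2 * \<kappa>) = 1 / a^2"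
        unfolding A_def \<kappa>_def g using ab a0 assms(2) by (simp add: divide_simps)
      also have "A * (1 + 2 * \<kappa>) = 1 / b^2"
        unfolding A_def \<kappa>_def g using ab a0 assms(2) by (simp add: divide_simps)
      \<comment> \<open>Matching this linear part determines \<open>f\<close>.\<close>
      also have "4 * A * \<kappa> * (Re f * X - Im f * Y) = 2 * x * X / a^2 + 2 * y * Y / b^2"
      proof -
        have AK: "4 * A * \<kappa> = g / (a^2 * b^2)" 
        proof -
          have "4 * (q / (2 * a^2 * b^2)) * (g / (2 * q)) = g / (a^2 * b^2)" if "q > 0" for q using that by simp
          thus ?thesis unfolding A_def \<kappa>_def using ab by blast
        qed
        show ?thesis unfolding AK f_def complex.sel using g0 a0 assms(2) by (simp add: field_simps)
      qed
      \<comment> \<open>Only the constant term needs the position of \<open>C\<close>: with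
        \<open>f\<close> fixed by the linear part, this equation is the membership of
        \<open>C\<close> in the ellipse of equilateral centroids.\<close>
      also have "4 * A * (cmod f)^2 = 1 - x^2 / a^2 - y^2 / b^2"
      proof -
        have "4 * A * (cmod f)^2 = x^2 * (8 * (a^2 + b^2) * b^2) / (a^2 * g^2) + y^2 * (8 * (a^2 + b^2) * a^2) / (b^2 * g^2)"
        proof -
          have *: "4 * (q / (2 * a^2 * b^2)) * ((2 * b^2 * x / g)^2 + (- (2 * a^2 * y / g))^2) =
            x^2 * (8 * q * b^2) / (a^2 * g^2) + y^2 * (8 * q * a^2) / (b^2 * g^2)" for q
            using g0 a0 assms(2) by (simp add: distrib_left power2_eq_square mult_ac)
          show ?thesis unfolding A_def cmod_power2 f_def complex.sel by (rule *)
        qed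
        moreover have "8 * (a^2 + b^2) * b^2 = (a^2 + 3 * b^2)^2 - g^2" unfolding g by algebra
        moreover have "8 * (a^2 + b^2) * a^2 = (3 * a^2 + b^2)^2 - g^2" unfolding g by algebra
        ultimately show ?thesis using on g0 a0 assms(2)
          by (simp add: right_diff_distrib diff_divide_distrib)
      qed
      finally show ?thesis using a0 assms(2)
        unfolding frame_def vector_add_component vec2_nth x_def[symmetric] y_def[symmetric] X_def[symmetric] Y_def[symmetric]
        by (simp add: power2_sum add_divide_distrib)
    qed
  qed
  show ?thesis using L_is_ellipse missing_point_in_L locus_eq_L_minus_point L_touches by blast
qed

end
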